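(* Let $T^0,E,\widetilde E_t,\widehat E,\hat u_i,u_i^*,\tilde u_i^*,P_t^e,F_{P_t^e},\lambda_n,\lambda_N,\hat\lambda_N,\tilde\lambda_N^t,\bar\delta_b$ be as defined in the context. Let $\hat\eta,\tilde\eta\ge0$ be given by $$\hat\eta^2:=\lambda_N\,\bar\delta_b^2(\widehat E,E)+\hat\lambda_N-\lambda_n,\qquad \tilde\eta^2:=\lambda_N\,\bar\delta_b^2(E,\widetilde E_t)+\tilde\lambda_N^t-\lambda_n .$$ Then for each element of the matrices $M_t^*:=(F_{P_t^e}(\tilde u_i^*,u_j^* ))_{i,j=n}^N$ and $N_t^*:=((\tilde u_i^*,u_j^* )_{T^0})_{i,j=n}^N$, i.e. for all $i,j=n,\dots,N$, $$\left|F_{P_t^e}(\tilde u_i^*,u_j^* )-F_{P_t^e}(\hat u_i,\hat u_j)\right|\le \mathrm{Err}_F(P_t^e;E,\widehat E)$$ and $$\left|(\tilde u_i^*,u_j^* )_{T^0}-(\hat u_i,\hat u_j)_{T^0}\right|\le \mathrm{Err}_b(P_t^e;E,\widehat E),$$ where $$\mathrm{Err}_F(P_t^e;E,\widehat E):=\|P_t^e\|_2\left(2\hat\eta\sqrt{\hat\lambda_N}+\tilde\eta\sqrt{\lambda_N}\right),\qquad \mathrm{Err}_b(P_t^e;E,\widehat E):=2\bar\delta_b(\widehat E,E)+\bar\delta_b(E,\widetilde E_t).$$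
   Context: For $p=(x,y)\in\mathbb{R}^2$, $T^p$ is the triangular domain with vertices $(0,0),(1,0),(x,y)$ (so $y\neq0$), and $\lambda_1^p<\lambda_2^p\le\lambda_3^p\le\cdots$ are its Dirichlet Laplacian eigenvalues counted with multiplicity (weak form: $(\nabla u,\nabla v)_{T^p}=\lambda(u,v)_{T^p}$ for all $v\in H^1_0(T^p)$, where $(\cdot,\cdot)_T$ and $\|\cdot\|_T$ are the inner product and norm of $L^2(T)$ or $(L^2(T))^2$). Fix indices $n\le N$ with $\lambda_n^p=\cdots=\lambda_N^p=:\lambda$; write $\lambda_n=\lambda_N=\lambda$; let $E\subset H^1_0(T^p)$ be the eigenspace corresponding to $\lambda$. For $t>0$ and a unit vector $e\in\mathbb{R}^2$, let $p_t:=p+te=:(\tilde x,\tilde y)$ (again with $T^{p_t}$ a triangle, so $\tilde y\ne0$), $T^0:=T^p$, $T^t:=T^{p_t}$, $\lambda_i^t:=\lambda_i^{p_t}$. Let $u_n^t,\dots,u_N^t$ be linearly independent Dirichlet eigenfunctions on $T^t$ corresponding to $\lambda_n^t,\dots,\lambda_N^t$ respectively. Let $S_t=\begin{pmatrix}1&(\tilde x-x)/y\\0&\tilde y/y\end{pmatrix}$, the linear map taking $T^0$ to $T^t$; $\tilde u_i^t:=u_i^t\circ S_t\in H^1_0(T^0)$; $\widetilde E_t:=\mathrm{span}\{\tilde u_n^t,\dots,\tilde u_N^t\}$; $\tilde\lambda_N^t:=\max_{0\ne\tilde u\in\widetilde E_t}\|\nabla\tilde u\|_{T^0}^2/\|\tilde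 u\|_{T^0}^2$. Let $P_t^e:=(S_t^{-1}S_t^{-\intercal}-I)/t$ (symmetric $2\times2$ matrix, $\|\cdot\|_2$ its spectral norm) and $F_{P_t^e}(u,v):=(P_t^e\nabla u,\nabla v)_{T^0}$ for $u,v\in H^1_0(T^0)$. Let $\hat u_n,\dots,\hat u_N\in H^1_0(T^0)$ be $L^2$-normalized approximations of the eigenfunctions corresponding to $\lambda_n^p=\cdots=\lambda_N^p$, $\widehat E:=\mathrm{span}\{\hat u_n,\dots,\hat u_N\}$, and $\hat\lambda_N:=\max_{0\neq\hat u\in\widehat E}\|\nabla\hat u\|_{T^0}^2/\|\hat u\|_{T^0}^2$. For finite-dimensional nonzero subspaces $G,G'\subset H^1_0(T^0)$, $$\bar\delta_b(G,G'):=\max_{v\in G,\ \|v\|_{T^0}=1}\ \min_{v'\in G',\ \|v'\|_{T^0}=1}\|v-v'\|_{T^0}.$$ For each $i=n,\dots,N$, $u_i^*\in E$ is a function chosen with $\|\hat u_i-u_i^*\|_{T^0}\le\bar\delta_b(\widehat E,E)$ and $\|u_i^*\|_{T^0}=1$, and $\tilde u_i^*\in\widetilde E_t$ is chosen with $\|u_i^*-\tilde u_i^*\|_{T^0}\le\bar\delta_b(E,\widetilde E_t)$ and $\|\tilde u_i^*\|_{T^0}=1$ (such functions exist by definition of $\bar\delta_b$).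
   Formalization: The first inequality (for F) is stated under the extra condition λ_N ≤ λ̂_N, automatic for Rayleigh–Ritz approximations; without it the claim fails, e.g. on the equilateral triangle with û taken to be the first eigenfunction and λ=64λ_1. The second inequality needs no such condition. *)

theory Defs
  imports "HOL-Analysis.Analysis"
begin

text \<open>
  Elements of \<open>L\<^sup>2(T)\<close> and \<open>H\<^sup>1\<^sub>0(T)\<close> are represented by total functions on the plane; only their
  restriction to \<open>T\<close> matters, and it matters only up to null sets.  Accordingly ``nonzero'',
  ``linearly independent'' and ``span'' are all understood modulo equality almost everywhere on \<open>T\<close>.
\<close>

definition triangle :: "real^2 \<Rightarrow> (real^2) set" where
  "triangle p = interior (convex hull {vector [0, 0], vector [1, 0], p})"


subsection \<open>The spaces \<open>L\<^sup>2(T)\<close> and \<open>(L\<^sup>2(T))\<^sup>2\<close>\<close>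

definition L2 :: "(real^2) set \<Rightarrow> (real^2 \<Rightarrow> 'b::euclidean_space) set" where
  "L2 T = {u. u \<in> borel_measurable (lebesgue_on T) \<and>
              integrable (lebesgue_on T) (\<lambda>x. (norm (u x))\<^sup>2)}"

definition L2_inner ::
  "(real^2) set \<Rightarrow> (real^2 \<Rightarrow> 'b::euclidean_space) \<Rightarrow> (real^2 \<Rightarrow> 'b) \<Rightarrow> real" where
  "L2_inner T u v = (LINT x|lebesgue_on T. u x \<bullet> v x)"

definition L2_norm :: "(real^2) set \<Rightarrow> (real^2 \<Rightarrow> 'b::euclidean_space) \<Rightarrow> real" where
  "L2_norm T u = sqrt (L2_inner T u u)"

definition L2_indep :: "(real^2) set \<Rightarrow> (nat \<Rightarrow> real^2 \<Rightarrow> real) \<Rightarrow> nat set \<Rightarrow> bool" where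
  "L2_indep T u I \<longleftrightarrow>
     (\<forall>c::nat \<Rightarrow> real. (AE x in lebesgue_on T. (\<Sum>i\<in>I. c i * u i x) = 0) \<longrightarrow> (\<forall>i\<in>I. c i = 0))"

definition L2_span :: "(real^2) set \<Rightarrow> (nat \<Rightarrow> real^2 \<Rightarrow> real) \<Rightarrow> nat set \<Rightarrow> (real^2 \<Rightarrow> real) set" where
  "L2_span T u I =
     {v. \<exists>c::nat \<Rightarrow> real. AE x in lebesgue_on T. v x = (\<Sum>i\<in>I. c i * u i x)}"


subsection \<open>The space \<open>H\<^sup>1\<^sub>0(T)\<close>\<close>

definition gradient :: "(real^2 \<Rightarrow> real) \<Rightarrow> real^2 \<Rightarrow> real^2" where
  "gradient f x = (\<chi> i. frechet_derivative f (at x) (axis i 1))"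

primrec C_k :: "nat \<Rightarrow> (real^2 \<Rightarrow> real) \<Rightarrow> bool" where
  "C_k 0 f \<longleftrightarrow> continuous_on UNIV f"
| "C_k (Suc k) f \<longleftrightarrow>
     (\<forall>x. f differentiable (at x)) \<and> (\<forall>i. C_k k (\<lambda>x. gradient f x $ i))"

definition test_function :: "(real^2) set \<Rightarrow> (real^2 \<Rightarrow> real) \<Rightarrow> bool" where
  "test_function T \<phi> \<longleftrightarrow>
     (\<forall>k. C_k k \<phi>) \<and> compact (closure {x. \<phi> x \<noteq> 0}) \<and> closure {x. \<phi> x \<noteq> 0} \<subseteq> T"

text \<open>
  \<open>H\<^sup>1\<^sub>0(T)\<close> is the closure of \<open>C\<^sub>c\<^sup>\<infinity>(T)\<close> in the \<open>H\<^sup>1\<close> norm: \<open>u\<close> belongs to it, with weak gradient \<open>g\<close>,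
  iff some sequence of test functions converges to \<open>u\<close> in \<open>L\<^sup>2(T)\<close> while its gradients converge to \<open>g\<close>
  in \<open>(L\<^sup>2(T))\<^sup>2\<close>.  Passing to the limit in the integration by parts formula shows that \<open>g\<close> is the
  distributional gradient of \<open>u\<close>, hence is determined by \<open>u\<close> almost everywhere on \<open>T\<close>.
\<close>

definition has_H10_gradient ::
  "(real^2) set \<Rightarrow> (real^2 \<Rightarrow> real) \<Rightarrow> (real^2 \<Rightarrow> real^2) \<Rightarrow> bool" where
  "has_H10_gradient T u g \<longleftrightarrow> u \<in> L2 T \<and> g \<in> L2 T \<and>
     (\<exists>\<phi>. (\<forall>k::nat. test_function T (\<phi> k)) \<and>
          (\<lambda>k. L2_norm T (\<lambda>x. \<phi> k x - u x)) \<longlonglongrightarrow> 0 \<and>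
          (\<lambda>k. L2_norm T (\<lambda>x. gradient (\<phi> k) x - g x)) \<longlonglongrightarrow> 0)"

definition H10 :: "(real^2) set \<Rightarrow> (real^2 \<Rightarrow> real) set" where
  "H10 T = {u. \<exists>g. has_H10_gradient T u g}"

definition weak_gradient :: "(real^2) set \<Rightarrow> (real^2 \<Rightarrow> real) \<Rightarrow> real^2 \<Rightarrow> real^2" where
  "weak_gradient T u = (SOME g. has_H10_gradient T u g)"


subsection \<open>Dirichlet eigenvalues\<close>

definition eigenspace :: "(real^2) set \<Rightarrow> real \<Rightarrow> (real^2 \<Rightarrow> real) set" where
  "eigenspace T \<mu> = {u \<in> H10 T. \<forall>v \<in> H10 T.
      L2_inner T (weak_gradient T u) (weak_gradient T v) = \<mu> * L2_inner T u v}"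

definition eigenfunction :: "(real^2) set \<Rightarrow> real \<Rightarrow> (real^2 \<Rightarrow> real) \<Rightarrow> bool" where
  "eigenfunction T \<mu> u \<longleftrightarrow> u \<in> eigenspace T \<mu> \<and> L2_norm T u \<noteq> 0"

text \<open>
  The \<open>k\<close>-th eigenvalue (\<open>k \<ge> 1\<close>) in nondecreasing order with multiplicity: the least \<open>\<mu>\<close> such that
  there are \<open>k\<close> linearly independent eigenfunctions with eigenvalues at most \<open>\<mu>\<close>.
\<close>

definition dirichlet_eigenvalue :: "(real^2) set \<Rightarrow> nat \<Rightarrow> real" where
  "dirichlet_eigenvalue T k = (LEAST \<mu>. \<exists>u \<nu>.
      (\<forall>i\<in>{1..k}. eigenfunction T (\<nu> i) (u i) \<and> \<nu> i \<le> \<mu>) \<and> L2_indep T u {1..k})"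


subsection \<open>Rayleigh quotients and the distance between subspaces\<close>

text \<open>
  Both quantities below are applied to finite-dimensional nonzero subspaces, for which the suprema
  and the infimum are attained, i.e. are the maxima and the minimum.
\<close>

definition max_rayleigh :: "(real^2) set \<Rightarrow> (real^2 \<Rightarrow> real) set \<Rightarrow> real" where
  "max_rayleigh T G =
     (SUP u \<in> {u \<in> G. L2_norm T u \<noteq> 0}. (L2_norm T (weak_gradient T u))\<^sup>2 / (L2_norm T u)\<^sup>2)"

definition delta_b :: "(real^2) set \<Rightarrow> (real^2 \<Rightarrow> real) set \<Rightarrow> (real^2 \<Rightarrow> real) set \<Rightarrow> real" where
  "delta_b T G G' =
     (SUP v \<in> {v \<in> G. L2_norm T v = 1}. INF v' \<in> {v' \<in> G'. L2_norm T v' = 1}.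
        L2_norm T (\<lambda>x. v x - v' x))"


subsection \<open>The perturbation of the triangle\<close>

definition S_mat :: "real^2 \<Rightarrow> real^2 \<Rightarrow> real^2^2" where
  "S_mat p q = vector [vector [1, (q $ 1 - p $ 1) / p $ 2],
                       vector [0, q $ 2 / p $ 2]]"

definition P_mat :: "real^2 \<Rightarrow> real^2 \<Rightarrow> real \<Rightarrow> real^2^2" where
  "P_mat p e t = (let S = S_mat p (p + t *\<^sub>R e) in
     (1 / t) *\<^sub>R (matrix_inv S ** transpose (matrix_inv S) - mat 1))"

definition F_form ::
  "(real^2) set \<Rightarrow> real^2^2 \<Rightarrow> (real^2 \<Rightarrow> real) \<Rightarrow> (real^2 \<Rightarrow> real) \<Rightarrow> real" where
  "F_form T P u v = L2_inner T (\<lambda>x. P *v weak_gradient T u x) (weak_gradient T v)"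

definition spectral_norm :: "real^2^2 \<Rightarrow> real" where
  "spectral_norm P = onorm (\<lambda>v. P *v v)"

end

theory Submission
  imports Defs
begin

text \<open>
  For a normalised eigenfunction \<open>u\<close> with eigenvalue \<open>\<lambda>\<close> and a normalised \<open>v \<in> H\<^sup>1\<^sub>0(T)\<close>, expanding the
  squares and using the weak form of the eigenvalue equation gives
  \<open>\<parallel>\<nabla>(u - v)\<parallel>\<^sup>2 = \<parallel>\<nabla>v\<parallel>\<^sup>2 - \<lambda> + \<lambda> \<parallel>u - v\<parallel>\<^sup>2\<close>.  Hence gradient errors are controlled by \<open>L\<^sup>2\<close> errors and the
  Rayleigh quotient of \<open>v\<close>, and both estimates follow by exchanging one argument at a time in the
  bilinear forms.  Bounding a Rayleigh quotient by the supremum over a finite-dimensional span requires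
  that supremum to be finite, which rests on the uniqueness of weak gradients; the pulled-back
  eigenfunctions belong to \<open>H\<^sup>1\<^sub>0\<close> by a linear change of variables.
\<close>

subsection \<open>The inner product of \<open>L\<^sup>2(T)\<close>\<close>

text \<open>\<open>weak_gradient\<close> is picked by Hilbert choice, so linearity in its argument
  cannot be read off from its definition. The eigenvalue equation is phrased with the same chosen
  gradients, which is why the error identity can be proved for the difference of two chosen
  gradients without any linearity. Rayleigh quotients are different: a bound uniform over a span has
  to compare the chosen gradient of a combination with the combination of the gradients, and for
  this any two gradients of one function must have the same norm. Finiteness matters because the
  supremum of an unbounded set of reals is an unspecified value that bounds nothing. The distances
  \<open>delta_b\<close>, by contrast, enter only as the numbers that bound the errors of the
  selected functions. The factor 2 in both estimates counts the two passages between a starred and a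
  hatted function, one in each argument; the tilde function occurs only in the first argument and
  contributes once.\<close>

lemma L2_measurable: "u \<in> L2 T \<Longrightarrow> u \<in> borel_measurable (lebesgue_on T)"
  by (simp add: L2_def)

lemma L2_inner_integrable:
  fixes u v :: "real^2 \<Rightarrow> 'b::euclidean_space"
  assumes "u \<in> L2 T" "v \<in> L2 T"
  shows "integrable (lebesgue_on T) (\<lambda>x. u x \<bullet> v x)"
proof (rule Bochner_Integration.integrable_bound)
  show "integrable (lebesgue_on T) (\<lambda>x. (norm (u x))\<^sup>2 + (norm (v x))\<^sup>2)"
    using assms by (auto simp: L2_def)
  show "(\<lambda>x. u x \<bullet> v x) \<in> borel_measurable (lebesgue_on T)"
    using assms by (auto simp: L2_def intro!: borel_measurable_inner)
  have "\<bar>u x \<bullet> v x\<bar> \<le> (norm (u x))\<^sup>2 + (norm (v x))\<^sup>2" for x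
    using Cauchy_Schwarz_ineq2[of "u x" "v x"] sum_squares_bound[of "norm (u x)" "norm (v x)"]
      zero_le_power2[of "norm (u x)"] zero_le_power2[of "norm (v x)"]
      mult_nonneg_nonneg[OF norm_ge_zero norm_ge_zero, of "u x" "v x"] by linarith
  then show "AE x in lebesgue_on T.
      norm (u x \<bullet> v x) \<le> norm ((norm (u x))\<^sup>2 + (norm (v x))\<^sup>2)" by auto
qed

lemma L2I:
  fixes u :: "real^2 \<Rightarrow> 'b::euclidean_space"
  assumes "u \<in> borel_measurable (lebesgue_on T)"
    "integrable (lebesgue_on T) f" "\<And>x. (norm (u x))\<^sup>2 \<le> f x"
  shows "u \<in> L2 T"
proof -
  have "integrable (lebesgue_on T) (\<lambda>x. (norm (u x))\<^sup>2)"
    using assms(2)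
  proof (rule Bochner_Integration.integrable_bound)
    show "(\<lambda>x. (norm (u x))\<^sup>2) \<in> borel_measurable (lebesgue_on T)"
      using assms(1) by measurable
    show "AE x in lebesgue_on T. norm ((norm (u x))\<^sup>2) \<le> norm (f x)"
      using assms(3) by (auto intro!: AE_I2 order_trans[OF assms(3)])
  qed
  with assms(1) show ?thesis by (simp add: L2_def)
qed

lemma L2_scaleR:
  fixes u :: "real^2 \<Rightarrow> 'b::euclidean_space"
  assumes "u \<in> L2 T" shows "(\<lambda>x. c *\<^sub>R u x) \<in> L2 T"
  using assms by (auto simp: L2_def power_mult_distrib)

lemma L2_add:
  fixes u v :: "real^2 \<Rightarrow> 'b::euclidean_space"
  assumes "u \<in> L2 T" "v \<in> L2 T" shows "(\<lambda>x. u x + v x) \<in> L2 T"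
proof (rule L2I)
  show "(\<lambda>x. u x + v x) \<in> borel_measurable (lebesgue_on T)"
    using assms by (auto simp: L2_def intro!: borel_measurable_add)
  show "integrable (lebesgue_on T) (\<lambda>x. u x \<bullet> u x + v x \<bullet> v x + 2 * (u x \<bullet> v x))"
    using assms by (intro Bochner_Integration.integrable_add integrable_mult_right L2_inner_integrable)
  show "(norm (u x + v x))\<^sup>2 \<le> u x \<bullet> u x + v x \<bullet> v x + 2 * (u x \<bullet> v x)" for x
    by (simp add: power2_norm_eq_inner inner_add inner_commute)
qed

lemma L2_diff:
  fixes u v :: "real^2 \<Rightarrow> 'b::euclidean_space"
  assumes "u \<in> L2 T" "v \<in> L2 T" shows "(\<lambda>x. u x - v x) \<in> L2 T"
  using L2_add[OF assms(1) L2_scaleR[OF assms(2), of "-1"]] by simp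

lemma L2_zero: "(\<lambda>x. 0 :: 'b::euclidean_space) \<in> L2 T"
  by (simp add: L2_def)

section \<open>Bilinearity, Cauchy-Schwarz and the triangle inequality for the L2 seminorm\<close>

lemma L2_inner_commute: "L2_inner T u v = L2_inner T v u"
  by (simp add: L2_inner_def inner_commute)

lemma L2_inner_add_left:
  assumes "u \<in> L2 T" "v \<in> L2 T" "w \<in> L2 T"
  shows "L2_inner T (\<lambda>x. u x + v x) w = L2_inner T u w + L2_inner T v w"
  unfolding L2_inner_def inner_add_left
  by (rule Bochner_Integration.integral_add) (auto intro!: L2_inner_integrable assms)

lemma L2_inner_diff_left:
  assumes "u \<in> L2 T" "v \<in> L2 T" "w \<in> L2 T"
  shows "L2_inner T (\<lambda>x. u x - v x) w = L2_inner T u w - L2_inner T v w"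
  unfolding L2_inner_def inner_diff_left
  by (rule Bochner_Integration.integral_diff) (auto intro!: L2_inner_integrable assms)

lemma L2_inner_diff_right:
  assumes "u \<in> L2 T" "v \<in> L2 T" "w \<in> L2 T"
  shows "L2_inner T w (\<lambda>x. u x - v x) = L2_inner T w u - L2_inner T w v"
  using L2_inner_diff_left[OF assms] by (simp add: L2_inner_commute)

lemma L2_inner_scaleR_left: "L2_inner T (\<lambda>x. c *\<^sub>R u x) w = c * L2_inner T u w"
  by (simp add: L2_inner_def)

lemma L2_inner_nonneg: "0 \<le> L2_inner T u u"
  by (simp add: L2_inner_def)

lemma L2_norm_power2: "(L2_norm T u)\<^sup>2 = L2_inner T u u"
  by (simp add: L2_norm_def L2_inner_nonneg)

lemma L2_norm_nonneg: "0 \<le> L2_norm T u"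
  by (simp add: L2_norm_def L2_inner_nonneg)

lemma L2_inner_scaleR_right: "L2_inner T w (\<lambda>x. c *\<^sub>R u x) = c * L2_inner T w u"
  by (simp add: L2_inner_def)

lemma L2_norm_scaleR: "L2_norm T (\<lambda>x. c *\<^sub>R u x) = \<bar>c\<bar> * L2_norm T u"
  by (simp add: L2_norm_def L2_inner_scaleR_left L2_inner_scaleR_right real_sqrt_mult
      flip: mult.assoc)

lemma L2_norm_minus_commute: "L2_norm T (\<lambda>x. u x - v x) = L2_norm T (\<lambda>x. v x - u x)"
  using L2_norm_scaleR[of T "-1" "\<lambda>x. u x - v x"] by simp

lemma L2_inner_add_right:
  assumes "u \<in> L2 T" "v \<in> L2 T" "w \<in> L2 T"
  shows "L2_inner T w (\<lambda>x. u x + v x) = L2_inner T w u + L2_inner T w v"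
  using L2_inner_add_left[OF assms] by (simp add: L2_inner_commute)

lemma L2_norm_add_power2:
  assumes "u \<in> L2 T" "v \<in> L2 T"
  shows "(L2_norm T (\<lambda>x. u x + v x))\<^sup>2 = (L2_norm T u)\<^sup>2 + 2 * L2_inner T u v + (L2_norm T v)\<^sup>2"
  using assms L2_inner_commute[of T v u]
  by (simp add: L2_norm_power2 L2_inner_add_left L2_inner_add_right L2_add)

lemma L2_norm_diff_power2:
  assumes "u \<in> L2 T" "v \<in> L2 T"
  shows "(L2_norm T (\<lambda>x. u x - v x))\<^sup>2 = (L2_norm T u)\<^sup>2 - 2 * L2_inner T u v + (L2_norm T v)\<^sup>2"
  using assms L2_inner_commute[of T v u]
  by (simp add: L2_norm_power2 L2_inner_diff_left L2_inner_diff_right L2_diff)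

text \<open>The squared norm of \<open>u + s v\<close> is a nonnegative quadratic in
  \<open>s\<close>, so its discriminant is nonpositive. As \<open>L2_norm\<close> is only a seminorm
  on functions, the case \<open>c = 0\<close> needs its own argument.\<close>

lemma L2_Cauchy_Schwarz:
  assumes u: "u \<in> L2 T" and v: "v \<in> L2 T"
  shows "\<bar>L2_inner T u v\<bar> \<le> L2_norm T u * L2_norm T v"
proof -
  define a b c where "a = (L2_norm T u)\<^sup>2" "b = L2_inner T u v" "c = (L2_norm T v)\<^sup>2"
  have q: "0 \<le> a + 2 * s * b + s\<^sup>2 * c" for s
  proof -
    have "0 \<le> (L2_norm T (\<lambda>x. u x + s *\<^sub>R v x))\<^sup>2" by simp
    also have "\<dots> = a + 2 * s * b + s\<^sup>2 * c"
      unfolding L2_norm_add_power2[OF u L2_scaleR[OF v]] a_b_c_def L2_norm_scaleR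
      by (simp add: L2_inner_scaleR_right power_mult_distrib)
    finally show ?thesis .
  qed
  have c0: "c \<ge> 0" by (simp add: a_b_c_def)
  have "b\<^sup>2 \<le> a * c"
  proof (cases "c = 0")
    case True
    have "b = 0"
    proof (rule ccontr)
      assume "b \<noteq> 0"
      \<comment> \<open>This value of \<open>s\<close> makes \<open>a + 2 * s * b\<close> equal to
        -1.\<close>
      then show False using q[of "- (a + 1) / (2 * b)"] True by (simp add: field_simps)
    qed
    then show ?thesis using True by simp
  next
    case False
    with c0 have "c > 0" by simp
    \<comment> \<open>The quadratic is evaluated at its minimiser \<open>- b / c\<close>, and the
      factor \<open>c\<close> clears the denominator.\<close>
    then have "0 \<le> c * (a + 2 * (- b / c) * b + (- b / c)\<^sup>2 * c)"
      using q[of "- b / c"] by (intro mult_nonneg_nonneg) auto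
    also have "\<dots> = a * c - b\<^sup>2" using \<open>c > 0\<close> by (simp add: field_simps power2_eq_square)
    finally show ?thesis by simp
  qed
  then have "\<bar>b\<bar>\<^sup>2 \<le> (L2_norm T u * L2_norm T v)\<^sup>2" by (simp add: a_b_c_def power_mult_distrib)
  then show ?thesis unfolding a_b_c_def
    by (rule power2_le_imp_le) (simp add: L2_norm_nonneg)
qed

lemma L2_norm_triangle:
  assumes u: "u \<in> L2 T" and v: "v \<in> L2 T"
  shows "L2_norm T (\<lambda>x. u x + v x) \<le> L2_norm T u + L2_norm T v"
proof (rule power2_le_imp_le)
  show "(L2_norm T (\<lambda>x. u x + v x))\<^sup>2 \<le> (L2_norm T u + L2_norm T v)\<^sup>2"
    using L2_Cauchy_Schwarz[OF u v] by (simp add: L2_norm_add_power2[OF u v] power2_sum)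
qed (simp add: L2_norm_nonneg)

lemma L2_inner_tendsto_left:
  assumes lim: "(\<lambda>k. L2_norm T (\<lambda>x. f k x - g x)) \<longlonglongrightarrow> 0"
    and f: "\<And>k. f k \<in> L2 T" and g: "g \<in> L2 T" and h: "h \<in> L2 T"
  shows "(\<lambda>k. L2_inner T (f k) h) \<longlonglongrightarrow> L2_inner T g h"
proof -
  have "(\<lambda>k. L2_inner T (f k) h - L2_inner T g h) \<longlonglongrightarrow> 0"
  proof (rule Lim_null_comparison)
    show "(\<lambda>k. L2_norm T (\<lambda>x. f k x - g x) * L2_norm T h) \<longlonglongrightarrow> 0"
      using tendsto_mult_right[OF lim, of "L2_norm T h"] by simp
    have "norm (L2_inner T (f k) h - L2_inner T g h) \<le> L2_norm T (\<lambda>x. f k x - g x) * L2_norm T h" for k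
      using L2_Cauchy_Schwarz[OF L2_diff[OF f g] h] by (simp add: L2_inner_diff_left f g h)
    then show "\<forall>\<^sub>F k in sequentially. norm (L2_inner T (f k) h - L2_inner T g h)
        \<le> L2_norm T (\<lambda>x. f k x - g x) * L2_norm T h" by simp
  qed
  then show ?thesis by (simp add: LIM_zero_iff)
qed

text \<open>Lebesgue measure is complete, so measurability survives a change on a null set.
  Extension by zero moves the question from \<open>T\<close> to the whole plane, where this is
  applied.\<close>

lemma L2_AE_cong:
  fixes u v :: "real^2 \<Rightarrow> 'b::euclidean_space"
  assumes T: "T \<in> sets lebesgue" and u: "u \<in> L2 T" and ae: "AE x in lebesgue_on T. u x = v x"
  shows "v \<in> L2 T"
proof -
  have "(\<lambda>x. if x \<in> T then u x else 0) \<in> borel_measurable lebesgue"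
    using L2_measurable[OF u] T by (simp add: borel_measurable_if)
  moreover have "AE x in lebesgue. (if x \<in> T then u x else 0) = (if x \<in> T then v x else 0)"
    using ae T by (simp add: AE_restrict_space_iff)
  ultimately have "(\<lambda>x. if x \<in> T then v x else 0) \<in> borel_measurable lebesgue"
    by (rule borel_measurable_AE)
  then have v: "v \<in> borel_measurable (lebesgue_on T)" using T by (simp add: borel_measurable_if)
  have "integrable (lebesgue_on T) (\<lambda>x. (norm (u x))\<^sup>2) =
      integrable (lebesgue_on T) (\<lambda>x. (norm (v x))\<^sup>2)"
    using v L2_measurable[OF u] ae by (intro integrable_cong_AE) auto
  with u v show ?thesis by (simp add: L2_def)
qed

lemma L2_inner_AE_cong:
  assumes "u \<in> L2 T" "u' \<in> L2 T" "v \<in> L2 T" "v' \<in> L2 T"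
    and "AE x in lebesgue_on T. u x = u' x" "AE x in lebesgue_on T. v x = v' x"
  shows "L2_inner T u v = L2_inner T u' v'"
  unfolding L2_inner_def
proof (rule integral_cong_AE)
  show "AE x in lebesgue_on T. u x \<bullet> v x = u' x \<bullet> v' x"
    using assms(5,6) by eventually_elim simp
qed (use assms in \<open>auto simp: L2_def intro!: borel_measurable_inner\<close>)

lemma L2_norm_AE_cong:
  assumes "u \<in> L2 T" "v \<in> L2 T" "AE x in lebesgue_on T. u x = v x"
  shows "L2_norm T u = L2_norm T v"
  unfolding L2_norm_def using assms by (metis L2_inner_AE_cong)

lemma L2_sum:
  fixes f :: "'i \<Rightarrow> real^2 \<Rightarrow> 'b::euclidean_space"
  shows "finite I \<Longrightarrow> (\<And>i. i \<in> I \<Longrightarrow> f i \<in> L2 T) \<Longrightarrow> (\<lambda>x. \<Sum>i\<in>I. f i x) \<in> L2 T"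
  by (induction rule: finite_induct) (auto intro: L2_zero L2_add)

lemma L2_inner_sum_left:
  assumes "finite I" "\<And>i. i \<in> I \<Longrightarrow> f i \<in> L2 T" "w \<in> L2 T"
  shows "L2_inner T (\<lambda>x. \<Sum>i\<in>I. f i x) w = (\<Sum>i\<in>I. L2_inner T (f i) w)"
  using assms by (induction rule: finite_induct)
    (simp_all add: L2_inner_add_left L2_sum, simp add: L2_inner_def)

subsection \<open>Gradients and integration by parts\<close>

lemma L2_continuous_compact_support:
  fixes f :: "real^2 \<Rightarrow> 'b::euclidean_space"
  assumes f: "continuous_on UNIV f" and K: "compact K" "\<And>x. x \<notin> K \<Longrightarrow> f x = 0"
    and T: "T \<in> sets lebesgue"
  shows "f \<in> L2 T"
proof -
  have f0: "f \<in> borel_measurable borel" by (rule borel_measurable_continuous_onI[OF f])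
  then have m: "f \<in> borel_measurable lebesgue" by (simp add: measurable_completion)
  have "integrable lborel (\<lambda>x. indicator K x *\<^sub>R (norm (f x))\<^sup>2)"
    by (rule borel_integrable_compact[OF K(1)])
      (intro continuous_intros continuous_on_subset[OF f] subset_UNIV)
  also have "(\<lambda>x. indicator K x *\<^sub>R (norm (f x))\<^sup>2) = (\<lambda>x. (norm (f x))\<^sup>2)"
    using K(2) by (auto simp: indicator_def fun_eq_iff)
  finally have "integrable lebesgue (\<lambda>x. (norm (f x))\<^sup>2)"
    using f0 by (subst integrable_completion) auto
  then have "integrable lebesgue (\<lambda>x. indicator T x *\<^sub>R (norm (f x))\<^sup>2)"
    using T by (intro integrable_mult_indicator)
  then have "integrable (lebesgue_on T) (\<lambda>x. (norm (f x))\<^sup>2)"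
    using T by (simp add: integrable_restrict_space)
  moreover have "f \<in> borel_measurable (lebesgue_on T)"
    using m by (rule measurable_restrict_space1)
  ultimately show ?thesis by (simp add: L2_def)
qed

text \<open>Moves integrals over \<open>T\<close> to the whole plane, where translation invariance
  is available.\<close>

lemma integral_lebesgue_on_eq_lborel:
  fixes f :: "real^2 \<Rightarrow> real"
  assumes f: "f \<in> borel_measurable borel" and T: "T \<in> sets lebesgue" "\<And>x. x \<notin> T \<Longrightarrow> f x = 0"
  shows "(LINT x|lebesgue_on T. f x) = (LINT x|lborel. f x)"
proof -
  have "(LINT x|lebesgue_on T. f x) = (LINT x|lebesgue. indicator T x *\<^sub>R f x)"
    using T by (simp add: integral_restrict_space)
  also have "(\<lambda>x. indicator T x *\<^sub>R f x) = f" using T(2) by (auto simp: indicator_def fun_eq_iff)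
  finally show ?thesis using f by (simp add: integral_completion)
qed

lemma frechet_derivative_eq_gradient:
  assumes "f differentiable (at x)"
  shows "frechet_derivative f (at x) v = gradient f x \<bullet> v"
proof -
  have lin: "linear (frechet_derivative f (at x))"
    by (rule linear_frechet_derivative[OF assms])
  have "frechet_derivative f (at x) v = frechet_derivative f (at x) (\<Sum>i\<in>UNIV. v $ i *\<^sub>R axis i 1)"
    by (simp add: basis_expansion flip: scalar_mult_eq_scaleR)
  also have "\<dots> = (\<Sum>i\<in>UNIV. v $ i *\<^sub>R frechet_derivative f (at x) (axis i 1))"
    by (simp add: linear_sum[OF lin] linear_scale[OF lin])
  also have "\<dots> = gradient f x \<bullet> v"
    by (simp add: gradient_def inner_vec_def mult.commute)
  finally show ?thesis .
qed

lemma has_derivative_gradient: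
  assumes "f differentiable (at x)"
  shows "(f has_derivative (\<lambda>v. gradient f x \<bullet> v)) (at x)"
proof -
  have "(f has_derivative frechet_derivative f (at x)) (at x)"
    using assms by (simp add: frechet_derivative_works)
  also have "frechet_derivative f (at x) = (\<lambda>v. gradient f x \<bullet> v)"
    using frechet_derivative_eq_gradient[OF assms] by auto
  finally show ?thesis .
qed

lemma gradient_eqI:
  assumes "(f has_derivative (\<lambda>v. g \<bullet> v)) (at x)"
  shows "gradient f x = g"
proof -
  have "frechet_derivative f (at x) = (\<lambda>v. g \<bullet> v)"
    using frechet_derivative_at[OF assms] by simp
  then show ?thesis by (simp add: gradient_def vec_eq_iff inner_axis)
qed

lemma gradient_eq_0_outside_support:
  assumes "x \<notin> closure {x. f x \<noteq> 0}"
  shows "gradient f x = 0"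
proof (rule gradient_eqI)
  have "((\<lambda>x. 0) has_derivative (\<lambda>v. 0)) (at x)" by simp
  then have "(f has_derivative (\<lambda>v. 0)) (at x)"
  proof (rule has_derivative_transform_within_open)
    show "open (- closure {x. f x \<noteq> 0})" by (rule open_Compl[OF closed_closure])
    show "x \<in> - closure {x. f x \<noteq> 0}" using assms by simp
    show "0 = f y" if "y \<in> - closure {x. f x \<noteq> 0}" for y
      using that closure_subset[of "{x. f x \<noteq> 0}"] by auto
  qed
  then show "(f has_derivative (\<lambda>v. 0 \<bullet> v)) (at x)" by simp
qed

text \<open>By translation invariance every difference quotient of \<open>f\<close> has integral
  zero, and dominated convergence passes this to the derivative. Iterated integrals are
  avoided.\<close>

lemma integral_partial_derivative_eq_0:
  fixes f :: "real^2 \<Rightarrow> real"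
  assumes diff: "\<And>x. f differentiable (at x)"
    and cont: "\<And>i. continuous_on UNIV (\<lambda>x. gradient f x $ i)"
    and K: "compact (closure {x. f x \<noteq> 0})"
  shows "(LINT x|lborel. gradient f x $ i) = 0"
proof -
  let ?K = "closure {x. f x \<noteq> 0}" and ?e = "axis i 1 :: real^2"
  have contf: "continuous_on UNIV f"
    using diff differentiable_imp_continuous_within by (auto simp: continuous_on_eq_continuous_within)
  have [measurable]: "f \<in> borel_measurable borel"
    by (rule borel_measurable_continuous_onI[OF contf])
  have [measurable]: "(\<lambda>x. gradient f x $ i) \<in> borel_measurable borel"
    by (rule borel_measurable_continuous_onI[OF cont])
  obtain R where R: "\<And>x. x \<in> ?K \<Longrightarrow> norm x \<le> R"
    using compact_imp_bounded[OF K] by (auto simp: bounded_iff)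
  have f0: "f x = 0" if "norm x > R" for x
    using R[of x] that closure_subset[of "{x. f x \<noteq> 0}"] by force
  have "compact ((\<lambda>x. gradient f x $ i) ` ?K)"
    by (rule compact_continuous_image[OF continuous_on_subset[OF cont subset_UNIV] K])
  then obtain M0 where M0: "\<And>x. x \<in> ?K \<Longrightarrow> \<bar>gradient f x $ i\<bar> \<le> M0"
    using compact_imp_bounded by (fastforce simp: bounded_iff)
  \<comment> \<open>The maximum with 0 covers points outside the support, where the gradient
    vanishes, and an empty support, where \<open>M0\<close> may be negative.\<close>
  define M where "M = max M0 0"
  have M: "\<bar>gradient f x $ i\<bar> \<le> M" for x
    using M0[of x] gradient_eq_0_outside_support[of x f] by (cases "x \<in> ?K") (auto simp: M_def)
  define h where "h n = 1 / real (Suc n)" for n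
  have h: "0 < h n" "h n \<le> 1" for n by (auto simp: h_def)
  have deriv: "((\<lambda>s. f (x + s *\<^sub>R ?e)) has_real_derivative gradient f (x + s *\<^sub>R ?e) $ i) (at s)" for x s
  proof -
    have "((\<lambda>s. x + s *\<^sub>R ?e) has_derivative (\<lambda>s. s *\<^sub>R ?e)) (at s)"
      by (auto intro!: derivative_eq_intros)
    from has_derivative_compose[OF this has_derivative_gradient[OF diff]]
    show ?thesis
      by (rule has_derivative_imp_has_field_derivative) (simp add: inner_axis)
  qed
  define q where "q n x = (f (h n *\<^sub>R ?e + x) - f x) / h n" for n x
  \<comment> \<open>The integrable majorant: the mean value theorem bounds the quotient by
    \<open>M\<close>, and since shifts have length at most 1, both values of \<open>f\<close> vanish
    outside the ball of radius \<open>R + 1\<close>.\<close>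
  have bound: "norm (q n x) \<le> indicator (cball 0 (R + 1)) x *\<^sub>R M" for n x
  proof (cases "norm x \<le> R + 1")
    case True
    obtain z where "f (x + h n *\<^sub>R ?e) - f (x + 0 *\<^sub>R ?e) = (h n - 0) * gradient f (x + z *\<^sub>R ?e) $ i"
      using MVT2[where a = 0 and b = "h n" and f = "\<lambda>s. f (x + s *\<^sub>R ?e)"
          and f' = "\<lambda>s. gradient f (x + s *\<^sub>R ?e) $ i"] h(1) deriv
      by blast
    then have "q n x = gradient f (x + z *\<^sub>R ?e) $ i"
      using h(1)[of n] by (simp add: q_def add.commute)
    then show ?thesis using M True by (simp add: indicator_def)
  next
    case False
    have "norm (h n *\<^sub>R ?e) \<le> 1" using h[of n] by (simp add: norm_axis_1)
    then have "norm (h n *\<^sub>R ?e + x) > R" "norm x > R"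
      using False norm_diff_ineq[of x "h n *\<^sub>R ?e"] by (auto simp: add.commute)
    then show ?thesis using f0 False by (simp add: q_def indicator_def)
  qed
  have int_f: "integrable lborel f"
  proof -
    have "integrable lborel (\<lambda>x. indicator ?K x *\<^sub>R f x)"
      by (rule borel_integrable_compact[OF K continuous_on_subset[OF contf subset_UNIV]])
    also have "(\<lambda>x. indicator ?K x *\<^sub>R f x) = f"
      using closure_subset[of "{x. f x \<noteq> 0}"] by (force simp: indicator_def fun_eq_iff)
    finally show ?thesis .
  qed
  have shift: "integrable lborel (\<lambda>x. f (c + x))" "(LINT x|lborel. f (c + x)) = (LINT x|lborel. f x)" for c
  proof -
    have "integrable (distr lborel borel ((+) c)) f"
      using int_f by (simp add: lborel_distr_plus)
    then show "integrable lborel (\<lambda>x. f (c + x))"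
      by (rule integrable_distr[rotated]) simp
    have "(LINT x|distr lborel borel ((+) c). f x) = (LINT x|lborel. f (c + x))"
      by (rule integral_distr) simp_all
    then show "(LINT x|lborel. f (c + x)) = (LINT x|lborel. f x)"
      by (simp add: lborel_distr_plus)
  qed
  have "(\<lambda>n. LINT x|lborel. q n x) \<longlonglongrightarrow> (LINT x|lborel. gradient f x $ i)"
  proof (rule integral_dominated_convergence)
    show "integrable lborel (\<lambda>x. indicator (cball 0 (R + 1)) x *\<^sub>R M)"
      by (rule borel_integrable_compact) auto
    show "AE x in lborel. (\<lambda>n. q n x) \<longlonglongrightarrow> gradient f x $ i"
    proof (rule AE_I2)
      fix x
      have "((\<lambda>s. (f (x + s *\<^sub>R ?e) - f x) / s) \<longlongrightarrow> gradient f x $ i) (at 0)"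
        using deriv[of x 0] by (simp add: DERIV_def)
      moreover have "filterlim h (at 0) sequentially"
        unfolding filterlim_at h_def using LIMSEQ_inverse_real_of_nat
        by (auto simp: inverse_eq_divide)
      ultimately show "(\<lambda>n. q n x) \<longlonglongrightarrow> gradient f x $ i"
        unfolding q_def by (auto dest: filterlim_compose simp: add.commute)
    qed
    show "AE x in lborel. norm (q n x) \<le> indicator (cball 0 (R + 1)) x *\<^sub>R M" for n
      using bound by simp
    show "(\<lambda>x. gradient f x $ i) \<in> borel_measurable lborel" by simp
    show "q n \<in> borel_measurable lborel" for n unfolding q_def by measurable
  qed
  moreover have "(LINT x|lborel. q n x) = 0" for n
  proof -
    have "(LINT x|lborel. q n x) = (LINT x|lborel. f (h n *\<^sub>R ?e + x) - f x) / h n"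
      unfolding q_def by (rule integral_divide_zero)
    also have "\<dots> = 0"
      by (simp add: Bochner_Integration.integral_diff shift int_f)
    finally show ?thesis .
  qed
  ultimately show ?thesis by (simp add: LIMSEQ_const_iff)
qed

section \<open>Test functions and integration by parts\<close>

lemma test_functionD:
  assumes "test_function T \<phi>"
  shows "\<phi> differentiable (at x)" "continuous_on UNIV \<phi>" "continuous_on UNIV (gradient \<phi>)"
    "compact (closure {x. \<phi> x \<noteq> 0})" "closure {x. \<phi> x \<noteq> 0} \<subseteq> T"
proof -
  have *: "C_k (Suc 0) \<phi>" and **: "C_k 0 \<phi>" using assms unfolding test_function_def by blast+
  show "\<phi> differentiable (at x)" "continuous_on UNIV \<phi>" using * ** by auto
  show "continuous_on UNIV (gradient \<phi>)"
    using * by (subst continuous_on_componentwise) (auto simp: Basis_vec_def inner_axis)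
qed (use assms in \<open>auto simp: test_function_def\<close>)

text \<open>Makes partial derivatives admissible in integration by parts, so that second derivatives
  of test functions can be formed and are square integrable.\<close>

lemma test_function_partial:
  assumes "test_function T \<phi>" shows "test_function T (\<lambda>x. gradient \<phi> x $ i)"
  unfolding test_function_def
proof (intro conjI allI)
  show "C_k k (\<lambda>x. gradient \<phi> x $ i)" for k
    using assms unfolding test_function_def by (metis C_k.simps(2))
  have sub: "closure {x. gradient \<phi> x $ i \<noteq> 0} \<subseteq> closure {x. \<phi> x \<noteq> 0}"
    using gradient_eq_0_outside_support[of _ \<phi>] by (intro closure_minimal) force+
  show "compact (closure {x. gradient \<phi> x $ i \<noteq> 0})"
    using compact_Int_closed[OF test_functionD(4)[OF assms], of "closure {x. gradient \<phi> x $ i \<noteq> 0}"] sub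
    by (simp add: Int_absorb1)
  show "closure {x. gradient \<phi> x $ i \<noteq> 0} \<subseteq> T"
    using sub test_functionD(5)[OF assms] by simp
qed

lemma test_function_L2:
  assumes "T \<in> sets lebesgue" "test_function T \<phi>"
  shows "\<phi> \<in> L2 T"
  by (rule L2_continuous_compact_support[OF test_functionD(2,4)[OF assms(2)] _ assms(1)])
    (use closure_subset[of "{x. \<phi> x \<noteq> 0}"] in auto)

lemma test_function_gradient_L2:
  assumes "T \<in> sets lebesgue" "test_function T \<phi>"
  shows "gradient \<phi> \<in> L2 T"
  by (rule L2_continuous_compact_support[OF test_functionD(3,4)[OF assms(2)] _ assms(1)])
    (rule gradient_eq_0_outside_support)

text \<open>The product rule for \<open>\<phi> x * \<psi> x\<close>, whose partial derivatives
  integrate to zero over the plane. Its support is compact and lies in \<open>T\<close>, so the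
  integral over \<open>T\<close> is the same and no boundary term arises.\<close>

lemma test_function_integration_by_parts:
  assumes T: "T \<in> sets lebesgue" and \<phi>: "test_function T \<phi>" and \<psi>: "test_function T \<psi>"
  shows "L2_inner T (\<lambda>x. gradient \<phi> x $ i) \<psi> = - L2_inner T \<phi> (\<lambda>x. gradient \<psi> x $ i)"
proof -
  note D = test_functionD[OF \<phi>] test_functionD[OF \<psi>]
  let ?f = "\<lambda>x. \<phi> x * \<psi> x"
  have der: "(?f has_derivative (\<lambda>v. (\<phi> x *\<^sub>R gradient \<psi> x + \<psi> x *\<^sub>R gradient \<phi> x) \<bullet> v)) (at x)" for x
    using has_derivative_mult[OF has_derivative_gradient[OF D(1)] has_derivative_gradient[OF D(6)]]
    by (simp add: inner_add_left algebra_simps)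
  have grad: "gradient ?f x = \<phi> x *\<^sub>R gradient \<psi> x + \<psi> x *\<^sub>R gradient \<phi> x" for x
    by (rule gradient_eqI[OF der])
  have sub: "closure {x. ?f x \<noteq> 0} \<subseteq> closure {x. \<phi> x \<noteq> 0}"
    by (intro closure_mono) auto
  have contg: "continuous_on UNIV (\<lambda>x. gradient ?f x $ j)" for j
    unfolding grad by (intro continuous_intros D)
  have "(LINT x|lborel. gradient ?f x $ i) = 0"
  proof (rule integral_partial_derivative_eq_0)
    show "?f differentiable (at x)" for x using der by (auto simp: differentiable_def)
    show "compact (closure {x. ?f x \<noteq> 0})"
      using compact_Int_closed[OF D(4), of "closure {x. ?f x \<noteq> 0}"] sub by (simp add: Int_absorb1)
  qed (rule contg)
  moreover have "(LINT x|lebesgue_on T. gradient ?f x $ i) = (LINT x|lborel. gradient ?f x $ i)"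
  proof (rule integral_lebesgue_on_eq_lborel)
    show "gradient ?f x $ i = 0" if "x \<notin> T" for x
    proof -
      have "x \<notin> closure {x. ?f x \<noteq> 0}" using that sub D(5) by blast
      then show ?thesis by (simp add: gradient_eq_0_outside_support)
    qed
  qed (use T contg in \<open>auto intro: borel_measurable_continuous_onI\<close>)
  moreover have "(LINT x|lebesgue_on T. gradient ?f x $ i) =
      (LINT x|lebesgue_on T. \<phi> x \<bullet> gradient \<psi> x $ i) + (LINT x|lebesgue_on T. \<psi> x \<bullet> gradient \<phi> x $ i)"
    unfolding grad
    using L2_inner_integrable[OF test_function_L2[OF T \<phi>] test_function_L2[OF T test_function_partial[OF \<psi>]]]
      L2_inner_integrable[OF test_function_L2[OF T \<psi>] test_function_L2[OF T test_function_partial[OF \<phi>]]]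
    by simp
  ultimately show ?thesis
    by (simp add: L2_inner_def inner_commute mult.commute)
qed

subsection \<open>Uniqueness of the weak gradient\<close>

lemma gradient_linear_combination:
  assumes "f differentiable (at x)" "g differentiable (at x)"
  shows "(\<lambda>x. a * f x + b * g x) differentiable (at x)"
    "gradient (\<lambda>x. a * f x + b * g x) x = a *\<^sub>R gradient f x + b *\<^sub>R gradient g x"
proof -
  have "((\<lambda>x. a * f x + b * g x) has_derivative
      (\<lambda>v. (a *\<^sub>R gradient f x + b *\<^sub>R gradient g x) \<bullet> v)) (at x)"
    using has_derivative_add[OF has_derivative_mult_right[OF has_derivative_gradient[OF assms(1)], of a]
        has_derivative_mult_right[OF has_derivative_gradient[OF assms(2)], of b]]
    by (simp add: inner_add_left)
  then show "(\<lambda>x. a * f x + b * g x) differentiable (at x)"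
    "gradient (\<lambda>x. a * f x + b * g x) x = a *\<^sub>R gradient f x + b *\<^sub>R gradient g x"
    by (auto simp: differentiable_def intro: gradient_eqI)
qed

lemma C_k_linear_combination: "C_k k f \<Longrightarrow> C_k k g \<Longrightarrow> C_k k (\<lambda>x. a * f x + b * g x)"
  by (induction k arbitrary: f g)
    (auto simp: gradient_linear_combination intro!: continuous_intros)

lemma C_k_zero: "C_k k (\<lambda>x. 0)"
proof (induction k)
  case (Suc k)
  have "gradient (\<lambda>x. 0) x = 0" for x by (rule gradient_eqI) simp
  with Suc show ?case by simp
qed simp

lemma gradient_matrix_compose:
  assumes "f differentiable (at (A *v x))"
  shows "(\<lambda>x. f (A *v x)) differentiable (at x)"
    "gradient (\<lambda>x. f (A *v x)) x = transpose A *v gradient f (A *v x)"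
proof -
  have "((\<lambda>x. A *v x) has_derivative (\<lambda>v. A *v v)) (at x)"
    by (rule linear_imp_has_derivative) simp
  from has_derivative_compose[OF this has_derivative_gradient[OF assms]]
  have "((\<lambda>x. f (A *v x)) has_derivative (\<lambda>v. (transpose A *v gradient f (A *v x)) \<bullet> v)) (at x)"
    by (simp add: dot_lmul_matrix)
  then show "(\<lambda>x. f (A *v x)) differentiable (at x)"
    "gradient (\<lambda>x. f (A *v x)) x = transpose A *v gradient f (A *v x)"
    by (auto simp: differentiable_def intro: gradient_eqI)
qed

text \<open>By the chain rule each partial derivative of the composite is a fixed linear combination
  of partial derivatives of \<open>f\<close> composed with \<open>A\<close>; the induction
  hypothesis applies to these, hence the generalisation over \<open>f\<close>.\<close>

lemma C_k_matrix_compose: "C_k k f \<Longrightarrow> C_k k (\<lambda>x. f (A *v x))"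
proof (induction k arbitrary: f)
  case 0
  then show ?case
    using continuous_on_compose2[of UNIV f UNIV "\<lambda>x. A *v x"] by (simp add: matrix_vector_mult_linear_continuous_on)
next
  case (Suc k)
  have "gradient (\<lambda>x. f (A *v x)) x $ i =
      A $ 1 $ i * gradient f (A *v x) $ 1 + A $ 2 $ i * gradient f (A *v x) $ 2" for x i
    using Suc.prems gradient_matrix_compose(2)[of f A x]
    by (simp add: matrix_vector_mul_component transpose_def inner_vec_def sum_2)
  with Suc show ?case
    using Suc.IH[of "\<lambda>x. gradient f x $ _"]
    by (auto intro!: C_k_linear_combination gradient_matrix_compose(1))
qed

lemma test_function_linear_combination:
  assumes "test_function T \<phi>" "test_function T \<psi>"
  shows "test_function T (\<lambda>x. a * \<phi> x + b * \<psi> x)"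
proof -
  let ?K = "\<lambda>f::real^2 \<Rightarrow> real. closure {x. f x \<noteq> 0}"
  have sub: "?K (\<lambda>x. a * \<phi> x + b * \<psi> x) \<subseteq> ?K \<phi> \<union> ?K \<psi>"
    unfolding closure_Un[symmetric] by (rule closure_mono) auto
  have "compact (?K \<phi> \<union> ?K \<psi>)" using assms by (intro compact_Un) (auto simp: test_function_def)
  from compact_Int_closed[OF this, of "?K (\<lambda>x. a * \<phi> x + b * \<psi> x)"] sub
  have "compact (?K (\<lambda>x. a * \<phi> x + b * \<psi> x))" by (simp add: Int_absorb1)
  with sub assms show ?thesis
    by (auto simp: test_function_def C_k_linear_combination)
qed

section \<open>Linear structure of the space of functions with an H10 gradient\<close>

lemma has_H10_gradient_L2:
  assumes "has_H10_gradient T u g" shows "u \<in> L2 T" "g \<in> L2 T"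
  using assms by (auto simp: has_H10_gradient_def)

lemma has_H10_gradient_zero: "has_H10_gradient T (\<lambda>x. 0) (\<lambda>x. 0)"
proof -
  have "gradient (\<lambda>x. 0) x = 0" for x by (rule gradient_eqI) simp
  moreover have "test_function T (\<lambda>x. 0)" by (simp add: test_function_def C_k_zero)
  ultimately show ?thesis unfolding has_H10_gradient_def
    by (auto simp: L2_zero L2_norm_def L2_inner_def intro!: exI[of _ "\<lambda>k x. 0"])
qed

lemma L2_norm_linear_combination_le:
  fixes u v :: "real^2 \<Rightarrow> 'b::euclidean_space"
  assumes "u \<in> L2 T" "v \<in> L2 T"
  shows "L2_norm T (\<lambda>x. a *\<^sub>R u x + b *\<^sub>R v x) \<le> \<bar>a\<bar> * L2_norm T u + \<bar>b\<bar> * L2_norm T v"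
  using L2_norm_triangle[OF L2_scaleR[OF assms(1), of a] L2_scaleR[OF assms(2), of b]]
  by (simp add: L2_norm_scaleR)

lemma L2_norm_linear_combination_tendsto:
  fixes u v :: "real^2 \<Rightarrow> 'b::euclidean_space"
  assumes uk: "(\<lambda>k. L2_norm T (\<lambda>x. uk k x - u x)) \<longlonglongrightarrow> 0"
    and vk: "(\<lambda>k. L2_norm T (\<lambda>x. vk k x - v x)) \<longlonglongrightarrow> 0"
    and L2: "u \<in> L2 T" "v \<in> L2 T" "\<And>k. uk k \<in> L2 T" "\<And>k. vk k \<in> L2 T"
  shows "(\<lambda>k. L2_norm T (\<lambda>x. (a *\<^sub>R uk k x + b *\<^sub>R vk k x) - (a *\<^sub>R u x + b *\<^sub>R v x))) \<longlonglongrightarrow> 0"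
proof (rule Lim_null_comparison)
  show "(\<lambda>k. \<bar>a\<bar> * L2_norm T (\<lambda>x. uk k x - u x) + \<bar>b\<bar> * L2_norm T (\<lambda>x. vk k x - v x)) \<longlonglongrightarrow> 0"
    using tendsto_add[OF tendsto_mult_left[OF uk, of "\<bar>a\<bar>"] tendsto_mult_left[OF vk, of "\<bar>b\<bar>"]] by simp
  have "L2_norm T (\<lambda>x. (a *\<^sub>R uk k x + b *\<^sub>R vk k x) - (a *\<^sub>R u x + b *\<^sub>R v x))
      \<le> \<bar>a\<bar> * L2_norm T (\<lambda>x. uk k x - u x) + \<bar>b\<bar> * L2_norm T (\<lambda>x. vk k x - v x)" for k
    using L2_norm_linear_combination_le[OF L2_diff[OF L2(3,1)] L2_diff[OF L2(4,2)], of a k b k]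
    by (simp add: algebra_simps)
  then show "\<forall>\<^sub>F k in sequentially.
      norm (L2_norm T (\<lambda>x. (a *\<^sub>R uk k x + b *\<^sub>R vk k x) - (a *\<^sub>R u x + b *\<^sub>R v x)))
      \<le> \<bar>a\<bar> * L2_norm T (\<lambda>x. uk k x - u x) + \<bar>b\<bar> * L2_norm T (\<lambda>x. vk k x - v x)"
    by (simp add: L2_norm_nonneg)
qed

lemma has_H10_gradient_linear_combination:
  assumes T: "T \<in> sets lebesgue"
    and u: "has_H10_gradient T u g" and v: "has_H10_gradient T v h"
  shows "has_H10_gradient T (\<lambda>x. a * u x + b * v x) (\<lambda>x. a *\<^sub>R g x + b *\<^sub>R h x)"
proof -
  obtain \<phi> where \<phi>: "\<And>k. test_function T (\<phi> k)" "(\<lambda>k. L2_norm T (\<lambda>x. \<phi> k x - u x)) \<longlonglongrightarrow> 0"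
    "(\<lambda>k. L2_norm T (\<lambda>x. gradient (\<phi> k) x - g x)) \<longlonglongrightarrow> 0"
    using u by (auto simp: has_H10_gradient_def)
  obtain \<psi> where \<psi>: "\<And>k. test_function T (\<psi> k)" "(\<lambda>k. L2_norm T (\<lambda>x. \<psi> k x - v x)) \<longlonglongrightarrow> 0"
    "(\<lambda>k. L2_norm T (\<lambda>x. gradient (\<psi> k) x - h x)) \<longlonglongrightarrow> 0"
    using v by (auto simp: has_H10_gradient_def)
  note L2 = has_H10_gradient_L2[OF u] has_H10_gradient_L2[OF v]
    test_function_L2[OF T \<phi>(1)] test_function_L2[OF T \<psi>(1)]
    test_function_gradient_L2[OF T \<phi>(1)] test_function_gradient_L2[OF T \<psi>(1)]
  show ?thesis unfolding has_H10_gradient_def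
  proof (intro conjI exI allI)
    show "(\<lambda>x. a * u x + b * v x) \<in> L2 T"
      using L2_add[OF L2_scaleR[OF L2(1), of a] L2_scaleR[OF L2(3), of b]] by simp
    show "(\<lambda>x. a *\<^sub>R g x + b *\<^sub>R h x) \<in> L2 T" by (intro L2_add L2_scaleR L2)
    show "test_function T (\<lambda>x. a * \<phi> k x + b * \<psi> k x)" for k
      by (rule test_function_linear_combination[OF \<phi>(1) \<psi>(1)])
    show "(\<lambda>k. L2_norm T (\<lambda>x. a * \<phi> k x + b * \<psi> k x - (a * u x + b * v x))) \<longlonglongrightarrow> 0"
      using L2_norm_linear_combination_tendsto[OF \<phi>(2) \<psi>(2) L2(1,3) L2(5,6)] by simp
    show "(\<lambda>k. L2_norm T (\<lambda>x. gradient (\<lambda>x. a * \<phi> k x + b * \<psi> k x) x -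
        (a *\<^sub>R g x + b *\<^sub>R h x))) \<longlonglongrightarrow> 0"
      using L2_norm_linear_combination_tendsto[OF \<phi>(3) \<psi>(3) L2(2,4) L2(7,8)]
      by (simp add: gradient_linear_combination test_functionD(1)[OF \<phi>(1)] test_functionD(1)[OF \<psi>(1)])
  qed
qed

text \<open>Members of \<open>L2_span\<close> equal a linear combination only almost everywhere;
  this transfers the gradient of the combination to them.\<close>

lemma has_H10_gradient_AE_cong:
  assumes T: "T \<in> sets lebesgue" and u: "has_H10_gradient T u g"
    and ae: "AE x in lebesgue_on T. u x = v x"
  shows "has_H10_gradient T v g"
proof -
  have L2: "u \<in> L2 T" "v \<in> L2 T"
    using has_H10_gradient_L2(1)[OF u] L2_AE_cong[OF T _ ae] by auto
  have "L2_norm T (\<lambda>x. \<phi> x - u x) = L2_norm T (\<lambda>x. \<phi> x - v x)" if "test_function T \<phi>" for \<phi>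
    using ae by (intro L2_norm_AE_cong L2_diff L2 test_function_L2[OF T that]) auto
  with u L2 show ?thesis unfolding has_H10_gradient_def by auto
qed

text \<open>Integration by parts moves the derivative from \<phi> to the gradient of \<psi>. The
  point is that \<phi> enters the bound only through its own norm, not through its gradient.\<close>

lemma L2_inner_test_gradients_le:
  assumes T: "T \<in> sets lebesgue" and \<phi>: "test_function T \<phi>" and \<psi>: "test_function T \<psi>"
  shows "\<bar>L2_inner T (gradient \<phi>) (gradient \<psi>)\<bar>
    \<le> L2_norm T \<phi> * (\<Sum>i\<in>UNIV. L2_norm T (\<lambda>x. gradient (\<lambda>x. gradient \<psi> x $ i) x $ i))"
proof -
  note P = test_function_partial
  have "L2_inner T (gradient \<phi>) (gradient \<psi>) =
      (\<Sum>i\<in>UNIV. L2_inner T (\<lambda>x. gradient \<phi> x $ i) (\<lambda>x. gradient \<psi> x $ i))"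
    unfolding L2_inner_def inner_vec_def
    by (rule Bochner_Integration.integral_sum)
      (intro L2_inner_integrable test_function_L2[OF T] P \<phi> \<psi>)
  also have "\<dots> = - (\<Sum>i\<in>UNIV. L2_inner T \<phi> (\<lambda>x. gradient (\<lambda>x. gradient \<psi> x $ i) x $ i))"
    by (simp add: test_function_integration_by_parts[OF T \<phi> P[OF \<psi>]] sum_negf)
  also have "\<bar>\<dots>\<bar> \<le> (\<Sum>i\<in>UNIV. L2_norm T \<phi> * L2_norm T (\<lambda>x. gradient (\<lambda>x. gradient \<psi> x $ i) x $ i))"
    unfolding abs_minus_cancel
    by (intro sum_abs[THEN order_trans] sum_mono L2_Cauchy_Schwarz test_function_L2[OF T] P \<phi> \<psi>)
  finally show ?thesis by (simp add: sum_distrib_left)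
qed

text \<open>The gradients of an approximating sequence are themselves admissible in the integration by
  parts formula, so no density argument is needed: the limit gradient \<open>g\<close> is orthogonal to each of
  them and hence to itself.\<close>

lemma has_H10_gradient_null:
  assumes T: "T \<in> sets lebesgue" and u: "has_H10_gradient T u g" and u0: "L2_norm T u = 0"
  shows "L2_norm T g = 0"
proof -
  obtain \<phi> where \<phi>: "\<And>k. test_function T (\<phi> k)" "(\<lambda>k. L2_norm T (\<lambda>x. \<phi> k x - u x)) \<longlonglongrightarrow> 0"
    "(\<lambda>k. L2_norm T (\<lambda>x. gradient (\<phi> k) x - g x)) \<longlonglongrightarrow> 0"
    using u by (auto simp: has_H10_gradient_def)
  note L2 = has_H10_gradient_L2[OF u] test_function_L2[OF T \<phi>(1)] test_function_gradient_L2[OF T \<phi>(1)]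
  have "L2_norm T (\<phi> k) \<le> L2_norm T (\<lambda>x. \<phi> k x - u x)" for k
    using L2_norm_triangle[OF L2_diff[OF L2(3,1)] L2(1), of k] u0 by simp
  then have \<phi>0: "(\<lambda>k. L2_norm T (\<phi> k)) \<longlonglongrightarrow> 0"
    by (intro Lim_null_comparison[OF _ \<phi>(2)]) (simp add: L2_norm_nonneg)
  have orth: "L2_inner T g (gradient (\<phi> m)) = 0" for m
  proof -
    \<comment> \<open>\<open>C\<close> involves second derivatives of the fixed function
      \<open>\<phi> m\<close> only, so it stays constant while \<open>k\<close> tends to
      infinity.\<close>
    define C where "C = (\<Sum>i\<in>UNIV. L2_norm T (\<lambda>x. gradient (\<lambda>x. gradient (\<phi> m) x $ i) x $ i))"
    have "(\<lambda>k. L2_inner T (gradient (\<phi> k)) (gradient (\<phi> m))) \<longlonglongrightarrow> 0"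
    proof (rule Lim_null_comparison)
      show "\<forall>\<^sub>F k in sequentially. norm (L2_inner T (gradient (\<phi> k)) (gradient (\<phi> m)))
          \<le> L2_norm T (\<phi> k) * C"
        using L2_inner_test_gradients_le[OF T \<phi>(1) \<phi>(1)] by (simp add: C_def)
      show "(\<lambda>k. L2_norm T (\<phi> k) * C) \<longlonglongrightarrow> 0"
        using tendsto_mult_right[OF \<phi>0, of C] by simp
    qed
    with L2_inner_tendsto_left[OF \<phi>(3) L2(4,2) L2(4)] show ?thesis
      by (rule LIMSEQ_unique)
  qed
  have "(\<lambda>k. L2_inner T (gradient (\<phi> k)) g) \<longlonglongrightarrow> L2_inner T g g"
    by (rule L2_inner_tendsto_left[OF \<phi>(3) L2(4,2) L2(2)])
  moreover have "L2_inner T (gradient (\<phi> k)) g = 0" for k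
    using orth[of k] by (simp add: L2_inner_commute)
  ultimately have "L2_inner T g g = 0" by (simp add: LIMSEQ_const_iff)
  then show ?thesis by (simp add: L2_norm_def)
qed

lemma has_H10_gradient_weak_gradient:
  "u \<in> H10 T \<Longrightarrow> has_H10_gradient T u (weak_gradient T u)"
  using someI_ex[of "has_H10_gradient T u"] by (simp add: H10_def weak_gradient_def)

lemma H10_L2: "u \<in> H10 T \<Longrightarrow> u \<in> L2 T" "u \<in> H10 T \<Longrightarrow> weak_gradient T u \<in> L2 T"
  using has_H10_gradient_L2 has_H10_gradient_weak_gradient by blast+

text \<open>Two gradients of \<open>u\<close> differ by a gradient of \<open>u - u\<close>, which
  has norm zero. This is the bridge from the arbitrary choice in \<open>weak_gradient\<close> to a
  gradient known explicitly.\<close>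

lemma L2_norm_weak_gradient:
  assumes T: "T \<in> sets lebesgue" and u: "has_H10_gradient T u g"
  shows "L2_norm T (weak_gradient T u) = L2_norm T g"
proof -
  have u': "has_H10_gradient T u (weak_gradient T u)"
    using u by (intro has_H10_gradient_weak_gradient) (auto simp: H10_def)
  note L2 = has_H10_gradient_L2(2)[OF u] has_H10_gradient_L2(2)[OF u']
  have z: "L2_norm T (\<lambda>x. weak_gradient T u x - g x) = 0"
    using has_H10_gradient_null[OF T has_H10_gradient_linear_combination[OF T u' u, of 1 "-1"]]
    by (simp add: L2_norm_def L2_inner_def)
  have z': "L2_norm T (\<lambda>x. g x - weak_gradient T u x) = 0"
    using z by (simp add: L2_norm_minus_commute)
  show ?thesis
    using L2_norm_triangle[OF L2_diff[OF L2(2,1)] L2(1)] L2_norm_triangle[OF L2_diff[OF L2] L2(2)] z z'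
    by simp
qed

lemma has_H10_gradient_sum:
  assumes T: "T \<in> sets lebesgue" and "finite I" "\<And>i. i \<in> I \<Longrightarrow> has_H10_gradient T (w i) (g i)"
  shows "has_H10_gradient T (\<lambda>x. \<Sum>i\<in>I. c i * w i x) (\<lambda>x. \<Sum>i\<in>I. c i *\<^sub>R g i x)"
  using assms(2,3)
proof (induction rule: finite_induct)
  case empty
  show ?case by (simp add: has_H10_gradient_zero)
next
  case (insert a I)
  then show ?case
    using has_H10_gradient_linear_combination[OF T, of "w a" "g a" _ _ "c a" 1] by simp
qed

subsection \<open>Rayleigh quotients on finite-dimensional spans\<close>

text \<open>The induction on the number of functions is a Gram--Schmidt step: one function is split off
  and the remaining ones are replaced by their components orthogonal to it.\<close>

lemma H10_span_gradient_bound: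
  fixes w :: "'i \<Rightarrow> real^2 \<Rightarrow> real"
  assumes T: "T \<in> sets lebesgue" and "finite I" "\<And>i. i \<in> I \<Longrightarrow> has_H10_gradient T (w i) (g i)"
  shows "\<exists>C\<ge>0. \<forall>c. L2_norm T (\<lambda>x. \<Sum>i\<in>I. c i *\<^sub>R g i x) \<le> C * L2_norm T (\<lambda>x. \<Sum>i\<in>I. c i * w i x)"
  using assms(2,3)
proof (induction I arbitrary: w g rule: finite_induct)
  case empty
  then show ?case by (auto simp: L2_norm_def L2_inner_def)
next
  case (insert a I)
  let ?W = "\<lambda>c w x. \<Sum>i\<in>I. c i * w i x" and ?G = "\<lambda>c g x. \<Sum>i\<in>I. c i *\<^sub>R g i x"
  note wI = insert.prems[OF insertI2] and wa = insert.prems[OF insertI1]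
  note L2a = has_H10_gradient_L2[OF wa]
  have sum_H10: "has_H10_gradient T (?W c w') (?G c g')"
    if "\<And>i. i \<in> I \<Longrightarrow> has_H10_gradient T (w' i) (g' i)" for c w' g'
    by (rule has_H10_gradient_sum[OF T insert.hyps(1) that])
  show ?case
  proof (cases "L2_norm T (w a) = 0")
    \<comment> \<open>Both \<open>w a\<close> and \<open>g a\<close> have norm zero, so adding or
      removing multiples of them leaves norms unchanged and the constant for \<open>I\<close> still
      serves. Dependent families end up here, once projection has reduced a member to norm
      zero.\<close>
    case True
    then have ga: "L2_norm T (g a) = 0" by (rule has_H10_gradient_null[OF T wa])
    obtain C where C: "C \<ge> 0" "\<And>c. L2_norm T (?G c g) \<le> C * L2_norm T (?W c w)"
      using insert.IH[of w g, OF wI] by blast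
    have "L2_norm T (\<lambda>x. \<Sum>i\<in>insert a I. c i *\<^sub>R g i x)
        \<le> C * L2_norm T (\<lambda>x. \<Sum>i\<in>insert a I. c i * w i x)" for c
    proof -
      note S = has_H10_gradient_L2[OF sum_H10[of w g c, OF wI]]
      have "L2_norm T (\<lambda>x. c a *\<^sub>R g a x + ?G c g x) \<le> L2_norm T (?G c g)"
        using L2_norm_linear_combination_le[OF L2a(2) S(2), of "c a" 1] ga by simp
      also have "\<dots> \<le> C * L2_norm T (?W c w)" by (rule C)
      also have "L2_norm T (?W c w) \<le> L2_norm T (\<lambda>x. c a * w a x + ?W c w x)"
        using L2_norm_linear_combination_le[OF L2_add[OF L2_scaleR[OF L2a(1), of "c a"] S(1)] L2a(1), of 1 "- c a"]
          True by simp
      finally show ?thesis using insert.hyps C(1) by (simp add: mult_left_mono)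
    qed
    with C(1) show ?thesis by blast
  next
    case False
    define m where "m = L2_norm T (w a)"
    have m: "m > 0" using False L2_norm_nonneg[of T "w a"] by (simp add: m_def)
    \<comment> \<open>Coefficient of the orthogonal projection of \<open>w i\<close> onto
      \<open>w a\<close>. The same coefficients are used for \<open>g'\<close>, so that
      \<open>g' i\<close> remains a gradient of \<open>w' i\<close>.\<close>
    define b where "b i = L2_inner T (w i) (w a) / m\<^sup>2" for i
    define w' where "w' i = (\<lambda>x. 1 * w i x + (- b i) * w a x)" for i
    define g' where "g' i = (\<lambda>x. 1 *\<^sub>R g i x + (- b i) *\<^sub>R g a x)" for i
    have w': "has_H10_gradient T (w' i) (g' i)" if "i \<in> I" for i
      unfolding w'_def g'_def by (rule has_H10_gradient_linear_combination[OF T wI[OF that] wa])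
    obtain C where C: "C \<ge> 0" "\<And>c. L2_norm T (?G c g') \<le> C * L2_norm T (?W c w')"
      using insert.IH[of w' g', OF w'] by blast
    have orth': "L2_inner T (w' i) (w a) = 0" if "i \<in> I" for i
    proof -
      have "L2_inner T (w' i) (w a) = L2_inner T (w i) (w a) - b i * L2_inner T (w a) (w a)"
        using L2_inner_diff_left[OF has_H10_gradient_L2(1)[OF wI[OF that]] L2_scaleR[OF L2a(1)] L2a(1), of "b i"]
          L2_inner_scaleR_left[of T "b i" "w a" "w a"]
        by (simp add: w'_def)
      also have "L2_inner T (w a) (w a) = m\<^sup>2" by (simp add: m_def L2_norm_power2)
      finally show ?thesis using m by (simp add: b_def)
    qed
    have "L2_norm T (\<lambda>x. \<Sum>i\<in>insert a I. c i *\<^sub>R g i x)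
        \<le> (L2_norm T (g a) / m + C) * L2_norm T (\<lambda>x. \<Sum>i\<in>insert a I. c i * w i x)" for c
    proof -
      \<comment> \<open>Substituting \<open>w i = w' i + b i * w a\<close> collects this total
        coefficient of \<open>w a\<close>; the gradients split with the same coefficient.\<close>
      define d where "d = c a + (\<Sum>i\<in>I. c i * b i)"
      define W where "W = L2_norm T (\<lambda>x. \<Sum>i\<in>insert a I. c i * w i x)"
      note S = has_H10_gradient_L2[OF sum_H10[of w' g' c, OF w']]
      have Gsplit: "(\<lambda>x. \<Sum>i\<in>insert a I. c i *\<^sub>R g i x) = (\<lambda>x. d *\<^sub>R g a x + ?G c g' x)"
        using insert.hyps
        by (simp add: g'_def d_def scaleR_right_diff_distrib sum_subtractf scaleR_left_distrib
            scaleR_sum_left fun_eq_iff)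
      have Wsplit: "(\<lambda>x. \<Sum>i\<in>insert a I. c i * w i x) = (\<lambda>x. d *\<^sub>R w a x + ?W c w' x)"
        using insert.hyps
        by (simp add: w'_def d_def right_diff_distrib sum_subtractf distrib_right
            sum_distrib_right mult.assoc fun_eq_iff)
      have "L2_inner T (?W c w') (w a) = (\<Sum>i\<in>I. c i * L2_inner T (w' i) (w a))"
        using L2_inner_sum_left[OF insert.hyps(1) L2_scaleR[OF has_H10_gradient_L2(1)[OF w']] L2a(1), of "\<lambda>i. i" c]
          L2_inner_scaleR_left[of T _ "w' _" "w a"] by simp
      also have "\<dots> = 0" by (simp add: orth')
      finally have orth: "L2_inner T (w a) (?W c w') = 0" by (simp add: L2_inner_commute)
      have W2: "W\<^sup>2 = (\<bar>d\<bar> * m)\<^sup>2 + (L2_norm T (?W c w'))\<^sup>2"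
        using L2_norm_add_power2[OF L2_scaleR[OF L2a(1), of d] S(1)]
        by (simp add: W_def Wsplit L2_inner_scaleR_left orth L2_norm_scaleR m_def del: real_scaleR_def)
      have W0: "W \<ge> 0" by (simp add: W_def L2_norm_nonneg)
      have d: "\<bar>d\<bar> * m \<le> W" by (rule power2_le_imp_le[OF _ W0]) (simp add: W2)
      have r: "L2_norm T (?W c w') \<le> W" by (rule power2_le_imp_le[OF _ W0]) (simp add: W2)
      have "L2_norm T (\<lambda>x. d *\<^sub>R g a x + ?G c g' x) \<le> \<bar>d\<bar> * L2_norm T (g a) + L2_norm T (?G c g')"
        using L2_norm_linear_combination_le[OF L2a(2) S(2), of d 1] by simp
      \<comment> \<open>Origin of the constant: \<open>\<bar>d\<bar> * m\<close> is the length of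
        the component along \<open>w a\<close>, which by orthogonality is at most
        \<open>W\<close>.\<close>
      also have "\<bar>d\<bar> * L2_norm T (g a) = (L2_norm T (g a) / m) * (\<bar>d\<bar> * m)" using m by simp
      also have "\<dots> \<le> (L2_norm T (g a) / m) * W"
        using d m by (intro mult_left_mono) (auto simp: L2_norm_nonneg)
      also have "L2_norm T (?G c g') \<le> C * W"
        using C(2)[of c] mult_left_mono[OF r C(1)] by linarith
      finally show ?thesis unfolding Gsplit W_def[symmetric] by (simp add: distrib_right)
    qed
    moreover have "L2_norm T (g a) / m + C \<ge> 0"
      using m C(1) by (simp add: L2_norm_nonneg)
    ultimately show ?thesis by blast
  qed
qed

lemma L2_span_H10:
  assumes T: "T \<in> sets lebesgue" and I: "finite I" and u: "\<And>i. i \<in> I \<Longrightarrow> u i \<in> H10 T"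
    and w: "w \<in> L2_span T u I"
  shows "w \<in> H10 T"
proof -
  obtain c where c: "AE x in lebesgue_on T. w x = (\<Sum>i\<in>I. c i * u i x)"
    using w by (auto simp: L2_span_def)
  have "has_H10_gradient T (\<lambda>x. \<Sum>i\<in>I. c i * u i x) (\<lambda>x. \<Sum>i\<in>I. c i *\<^sub>R weak_gradient T (u i) x)"
    by (intro has_H10_gradient_sum T I has_H10_gradient_weak_gradient u)
  then have "has_H10_gradient T w (\<lambda>x. \<Sum>i\<in>I. c i *\<^sub>R weak_gradient T (u i) x)"
    by (rule has_H10_gradient_AE_cong[OF T]) (use c in auto)
  then show ?thesis by (auto simp: H10_def)
qed

lemma rayleigh_le_max_rayleigh:
  assumes T: "T \<in> sets lebesgue" and I: "finite I" and u: "\<And>i. i \<in> I \<Longrightarrow> u i \<in> H10 T"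
    and w: "w \<in> L2_span T u I" "L2_norm T w \<noteq> 0"
  shows "(L2_norm T (weak_gradient T w))\<^sup>2 / (L2_norm T w)\<^sup>2 \<le> max_rayleigh T (L2_span T u I)"
proof -
  have u': "has_H10_gradient T (u i) (weak_gradient T (u i))" if "i \<in> I" for i
    using u[OF that] by (rule has_H10_gradient_weak_gradient)
  obtain C where C: "C \<ge> 0" "\<And>c. L2_norm T (\<lambda>x. \<Sum>i\<in>I. c i *\<^sub>R weak_gradient T (u i) x)
      \<le> C * L2_norm T (\<lambda>x. \<Sum>i\<in>I. c i * u i x)"
    using H10_span_gradient_bound[of T I u "\<lambda>i. weak_gradient T (u i)", OF T I u'] by blast
  have "(L2_norm T (weak_gradient T v))\<^sup>2 / (L2_norm T v)\<^sup>2 \<le> C\<^sup>2"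
    if v: "v \<in> L2_span T u I" "L2_norm T v \<noteq> 0" for v
  proof -
    obtain c where c: "AE x in lebesgue_on T. v x = (\<Sum>i\<in>I. c i * u i x)"
      using v by (auto simp: L2_span_def)
    have s: "has_H10_gradient T (\<lambda>x. \<Sum>i\<in>I. c i * u i x) (\<lambda>x. \<Sum>i\<in>I. c i *\<^sub>R weak_gradient T (u i) x)"
      by (intro has_H10_gradient_sum T I u')
    then have s': "has_H10_gradient T v (\<lambda>x. \<Sum>i\<in>I. c i *\<^sub>R weak_gradient T (u i) x)"
      by (rule has_H10_gradient_AE_cong[OF T]) (use c in auto)
    have "L2_norm T v = L2_norm T (\<lambda>x. \<Sum>i\<in>I. c i * u i x)"
      by (rule L2_norm_AE_cong[OF has_H10_gradient_L2(1)[OF s'] has_H10_gradient_L2(1)[OF s] c])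
    \<comment> \<open>The chosen gradient of \<open>v\<close> need not be the combination of the
      chosen gradients, but the two have equal norms.\<close>
    with C(2)[of c] have "L2_norm T (weak_gradient T v) \<le> C * L2_norm T v"
      by (simp add: L2_norm_weak_gradient[OF T s'])
    then have "(L2_norm T (weak_gradient T v))\<^sup>2 \<le> (C * L2_norm T v)\<^sup>2"
      by (rule power_mono) (rule L2_norm_nonneg)
    with v(2) show ?thesis by (simp add: divide_le_eq power_mult_distrib)
  qed
  then have "bdd_above ((\<lambda>v. (L2_norm T (weak_gradient T v))\<^sup>2 / (L2_norm T v)\<^sup>2) `
      {v \<in> L2_span T u I. L2_norm T v \<noteq> 0})"
    by (intro bdd_aboveI2[where M = "C\<^sup>2"]) auto
  then show ?thesis unfolding max_rayleigh_def using w by (intro cSUP_upper) auto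
qed

subsection \<open>Linear changes of variables\<close>

lemma L2_matrix:
  assumes w: "w \<in> L2 T"
  shows "(\<lambda>x. M *v w x) \<in> L2 T" "L2_norm T (\<lambda>x. M *v w x) \<le> spectral_norm M * L2_norm T w"
proof -
  have bl: "bounded_linear (\<lambda>v. M *v v)" by (simp add: linear_linear)
  have le: "norm (M *v v) \<le> spectral_norm M * norm v" for v
    unfolding spectral_norm_def by (rule onorm[OF bl])
  have le2: "(norm (M *v v))\<^sup>2 \<le> (spectral_norm M)\<^sup>2 * (norm v)\<^sup>2" for v
    using power_mono[OF le norm_ge_zero, of v 2] by (simp add: power_mult_distrib)
  have int: "integrable (lebesgue_on T) (\<lambda>x. (spectral_norm M)\<^sup>2 * (norm (w x))\<^sup>2)"
    using w by (auto simp: L2_def)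
  have "(\<lambda>x. M *v w x) \<in> borel_measurable (lebesgue_on T)"
    by (rule measurable_compose[OF L2_measurable[OF w]])
      (simp add: borel_measurable_continuous_onI matrix_vector_mult_linear_continuous_on)
  then show L2: "(\<lambda>x. M *v w x) \<in> L2 T" by (rule L2I[OF _ int le2])
  have "(L2_norm T (\<lambda>x. M *v w x))\<^sup>2 \<le> (spectral_norm M)\<^sup>2 * (L2_norm T w)\<^sup>2"
    unfolding L2_norm_power2 L2_inner_def power2_norm_eq_inner[symmetric]
    using integral_mono[OF _ int le2] L2 by (simp add: L2_def)
  then show "L2_norm T (\<lambda>x. M *v w x) \<le> spectral_norm M * L2_norm T w"
    by (rule power2_le_imp_le[OF ord_le_eq_trans])
      (auto simp: power_mult_distrib L2_norm_nonneg spectral_norm_def intro!: mult_nonneg_nonneg onorm_pos_le bl)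
qed

lemma integral_matrix_image:
  fixes f :: "real^2 \<Rightarrow> real" and A :: "real^2^2"
  assumes A: "det A \<noteq> 0" and S: "S \<in> sets lebesgue" "(\<lambda>x. A *v x) ` S \<in> sets lebesgue"
    and f: "integrable (lebesgue_on ((\<lambda>x. A *v x) ` S)) f"
  shows "integrable (lebesgue_on S) (\<lambda>x. f (A *v x))"
    "(LINT x|lebesgue_on S. f (A *v x)) = (LINT x|lebesgue_on ((\<lambda>x. A *v x) ` S). f x) / \<bar>det A\<bar>"
proof -
  \<comment> \<open>The linear change of variables theorem concerns values in
    \<open>real^'n\<close>, so \<open>f\<close> is wrapped as a vector with one component and
    unwrapped at the end.\<close>
  let ?g = "\<lambda>x. A *v x" and ?F = "\<lambda>x. (\<chi> i. f x) :: real^1"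
  have lin: "linear ?g" by simp
  have iff: "integrable (lebesgue_on Q) h \<longleftrightarrow> (\<lambda>x. (\<chi> i. h x) :: real^1) absolutely_integrable_on Q"
    if "Q \<in> sets lebesgue" for Q and h :: "real^2 \<Rightarrow> real"
    unfolding absolutely_integrable_on_iff_component[OF that] using that
    by (simp add: set_integrable_def integrable_restrict_space)
  have F: "?F absolutely_integrable_on (?g ` S)" using f by (simp add: iff S)
  then have Fg: "(?F \<circ> ?g) absolutely_integrable_on S"
    using A by (simp add: absolutely_integrable_on_linear_image[OF lin])
  then show int: "integrable (lebesgue_on S) (\<lambda>x. f (A *v x))"
    by (simp add: iff S o_def)
  have "integral (?g ` S) ?F = \<bar>det A\<bar> *\<^sub>R integral S (?F \<circ> ?g)"
    using integral_change_of_variables_linear[OF lin disjI1[OF F]] by simp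
  then have "integral (?g ` S) ?F $ 1 = \<bar>det A\<bar> * integral S (?F \<circ> ?g) $ 1" by simp
  moreover have "integral (?g ` S) ?F $ 1 = integral (?g ` S) f"
    using integral_component_eq_cart[OF set_lebesgue_integral_eq_integral(1)[OF F], of 1] by simp
  moreover have "integral S (?F \<circ> ?g) $ 1 = integral S (\<lambda>x. f (A *v x))"
    using integral_component_eq_cart[OF set_lebesgue_integral_eq_integral(1)[OF Fg], of 1] by simp
  ultimately show "(LINT x|lebesgue_on S. f (A *v x)) = (LINT x|lebesgue_on (?g ` S). f x) / \<bar>det A\<bar>"
    using A by (simp add: lebesgue_integral_eq_integral S f int)
qed

text \<open>Members of \<open>L2\<close> are only Lebesgue measurable, so continuity of the map is
  not enough: preimages of null sets must be null. A preimage under \<open>A\<close> is an image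
  under the inverse \<open>B\<close>, and differentiable maps of the plane preserve negligible
  sets.\<close>

lemma measurable_matrix_lebesgue:
  fixes A :: "real^2^2"
  assumes A: "invertible A"
  shows "(\<lambda>x. A *v x) \<in> lebesgue \<rightarrow>\<^sub>M lebesgue"
proof (rule completion.measurable_completion2)
  let ?g = "\<lambda>x. A *v x"
  have g: "?g \<in> borel \<rightarrow>\<^sub>M borel"
    by (simp add: borel_measurable_continuous_onI matrix_vector_mult_linear_continuous_on)
  then show m: "?g \<in> lebesgue \<rightarrow>\<^sub>M lborel" by (simp add: measurable_completion)
  obtain B where B: "A ** B = mat 1" "B ** A = mat 1" using A by (auto simp: invertible_def)
  show "null_sets lborel \<subseteq> null_sets (distr lebesgue lborel ?g)"
  proof
    fix N assume N: "N \<in> null_sets (lborel :: (real^2) measure)"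
    have "?g -` N = (\<lambda>x. B *v x) ` N"
      using B by (force simp: matrix_vector_mul_assoc image_iff)
    moreover have "negligible ((\<lambda>x. B *v x) ` N)"
    proof (rule negligible_differentiable_image_negligible)
      show "negligible N" using N by (simp add: negligible_iff_null_sets null_sets_completionI)
      show "(\<lambda>x. B *v x) differentiable_on N" by (simp add: linear_imp_differentiable_on)
    qed simp
    ultimately have "?g -` N \<in> null_sets lebesgue" by (simp add: negligible_iff_null_sets)
    then show "N \<in> null_sets (distr lebesgue lborel ?g)"
      using N m by (auto simp: null_sets_def emeasure_distr)
  qed
qed

lemma L2_matrix_compose:
  fixes u :: "real^2 \<Rightarrow> 'b::euclidean_space" and A :: "real^2^2"
  assumes A: "invertible A" and S: "S \<in> sets lebesgue" "(\<lambda>x. A *v x) ` S \<in> sets lebesgue"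
    and u: "u \<in> L2 ((\<lambda>x. A *v x) ` S)"
  shows "(\<lambda>x. u (A *v x)) \<in> L2 S"
    "L2_norm S (\<lambda>x. u (A *v x)) = L2_norm ((\<lambda>x. A *v x) ` S) u / sqrt \<bar>det A\<bar>"
proof -
  have det: "det A \<noteq> 0" using A by (simp add: invertible_det_nz)
  have int: "integrable (lebesgue_on ((\<lambda>x. A *v x) ` S)) (\<lambda>x. (norm (u x))\<^sup>2)"
    using u by (simp add: L2_def)
  have "(\<lambda>x. A *v x) \<in> lebesgue_on S \<rightarrow>\<^sub>M lebesgue_on ((\<lambda>x. A *v x) ` S)"
    by (rule measurable_restrict_space3[OF measurable_matrix_lebesgue[OF A]]) auto
  from measurable_compose[OF this L2_measurable[OF u]]
  show "(\<lambda>x. u (A *v x)) \<in> L2 S"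
    using integral_matrix_image(1)[OF det S int] by (simp add: L2_def)
  show "L2_norm S (\<lambda>x. u (A *v x)) = L2_norm ((\<lambda>x. A *v x) ` S) u / sqrt \<bar>det A\<bar>"
    using integral_matrix_image(2)[OF det S int]
    by (simp add: L2_norm_def L2_inner_def power2_norm_eq_inner real_sqrt_divide)
qed

text \<open>The support is handled through two descriptions of one set: as a preimage under
  \<open>A\<close> it contains the new support, and as an image under the inverse \<open>B\<close>
  it is compact and lies in \<open>S\<close>.\<close>

lemma test_function_matrix_compose:
  fixes A :: "real^2^2"
  assumes A: "invertible A" and \<phi>: "test_function ((\<lambda>x. A *v x) ` S) \<phi>"
  shows "test_function S (\<lambda>x. \<phi> (A *v x))"
proof -
  obtain B where B: "A ** B = mat 1" "B ** A = mat 1" using A by (auto simp: invertible_def)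
  let ?K = "closure {x. \<phi> x \<noteq> 0}" and ?K' = "closure {x. \<phi> (A *v x) \<noteq> 0}"
  have eq: "(\<lambda>x. A *v x) -` ?K = (\<lambda>x. B *v x) ` ?K"
    using B by (force simp: matrix_vector_mul_assoc image_iff)
  have comp: "compact ((\<lambda>x. B *v x) ` ?K)"
    by (rule compact_continuous_image[OF matrix_vector_mult_linear_continuous_on test_functionD(4)[OF \<phi>]])
  have sub: "?K' \<subseteq> (\<lambda>x. B *v x) ` ?K"
    unfolding eq[symmetric]
  proof (rule closure_minimal)
    show "{x. \<phi> (A *v x) \<noteq> 0} \<subseteq> (\<lambda>x. A *v x) -` ?K"
      using closure_subset[of "{x. \<phi> x \<noteq> 0}"] by auto
    show "closed ((\<lambda>x. A *v x) -` ?K)" using comp eq by (simp add: compact_imp_closed)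
  qed
  have "(\<lambda>x. B *v x) ` ?K \<subseteq> (\<lambda>x. B *v x) ` (\<lambda>x. A *v x) ` S"
    using test_functionD(5)[OF \<phi>] by (rule image_mono)
  also have "\<dots> = S" using B by (simp add: image_image matrix_vector_mul_assoc)
  finally have "?K' \<subseteq> S" using sub by simp
  moreover have "compact ?K'"
    using compact_Int_closed[OF comp, of ?K'] sub by (simp add: Int_absorb1)
  ultimately show ?thesis
    using \<phi> by (auto simp: test_function_def intro!: C_k_matrix_compose)
qed

text \<open>The chain rule for test functions passes to the limit, since composition with
  \<open>A\<close> divides L2 norms by the constant \<open>sqrt \<bar>det A\<bar>\<close> and
  multiplication by the transpose is bounded.\<close>

lemma has_H10_gradient_matrix_compose:
  fixes A :: "real^2^2"
  assumes A: "invertible A" and S: "S \<in> sets lebesgue" "(\<lambda>x. A *v x) ` S \<in> sets lebesgue"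
    and u: "has_H10_gradient ((\<lambda>x. A *v x) ` S) u g"
  shows "has_H10_gradient S (\<lambda>x. u (A *v x)) (\<lambda>x. transpose A *v g (A *v x))"
proof -
  let ?T = "(\<lambda>x. A *v x) ` S" and ?d = "sqrt \<bar>det A\<bar>" and ?s = "spectral_norm (transpose A)"
  obtain \<phi> where \<phi>: "\<And>k. test_function ?T (\<phi> k)" "(\<lambda>k. L2_norm ?T (\<lambda>x. \<phi> k x - u x)) \<longlonglongrightarrow> 0"
    "(\<lambda>k. L2_norm ?T (\<lambda>x. gradient (\<phi> k) x - g x)) \<longlonglongrightarrow> 0"
    using u by (auto simp: has_H10_gradient_def)
  note L2 = has_H10_gradient_L2[OF u] test_function_L2[OF S(2) \<phi>(1)] test_function_gradient_L2[OF S(2) \<phi>(1)]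
  note C = L2_matrix_compose[OF A S]
  show ?thesis unfolding has_H10_gradient_def
  proof (intro conjI exI allI)
    show "(\<lambda>x. u (A *v x)) \<in> L2 S" by (rule C(1)[OF L2(1)])
    show "(\<lambda>x. transpose A *v g (A *v x)) \<in> L2 S" by (rule L2_matrix(1)[OF C(1)[OF L2(2)]])
    show "test_function S (\<lambda>x. \<phi> k (A *v x))" for k
      by (rule test_function_matrix_compose[OF A \<phi>(1)])
    show "(\<lambda>k. L2_norm S (\<lambda>x. \<phi> k (A *v x) - u (A *v x))) \<longlonglongrightarrow> 0"
      using tendsto_divide[OF \<phi>(2) tendsto_const, of ?d] A
      by (simp add: C(2)[OF L2_diff[OF L2(3,1)]] invertible_det_nz)
    show "(\<lambda>k. L2_norm S (\<lambda>x. gradient (\<lambda>x. \<phi> k (A *v x)) x - transpose A *v g (A *v x))) \<longlonglongrightarrow> 0"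
    proof (rule Lim_null_comparison)
      show "(\<lambda>k. ?s * (L2_norm ?T (\<lambda>x. gradient (\<phi> k) x - g x) / ?d)) \<longlonglongrightarrow> 0"
        using tendsto_mult_left[OF tendsto_divide[OF \<phi>(3) tendsto_const, of ?d], of ?s] A
        by (simp add: invertible_det_nz)
      have "L2_norm S (\<lambda>x. gradient (\<lambda>x. \<phi> k (A *v x)) x - transpose A *v g (A *v x))
          \<le> ?s * (L2_norm ?T (\<lambda>x. gradient (\<phi> k) x - g x) / ?d)" for k
        using L2_matrix(2)[OF C(1)[OF L2_diff[OF L2(4,2)]], of "transpose A" k]
        by (simp add: C(2)[OF L2_diff[OF L2(4,2)]] matrix_vector_mult_diff_distrib
            gradient_matrix_compose(2)[OF test_functionD(1)[OF \<phi>(1)]])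
      then show "\<forall>\<^sub>F k in sequentially. norm (L2_norm S (\<lambda>x. gradient (\<lambda>x. \<phi> k (A *v x)) x
          - transpose A *v g (A *v x))) \<le> ?s * (L2_norm ?T (\<lambda>x. gradient (\<phi> k) x - g x) / ?d)"
        by (simp add: L2_norm_nonneg)
    qed
  qed
qed

subsection \<open>The perturbation estimates\<close>

text \<open>The map fixes the two common vertices and sends \<open>p\<close> to \<open>q\<close>;
  injective linear maps of the plane commute with convex hulls and interiors.\<close>

lemma S_mat_props:
  assumes "p $ 2 \<noteq> 0" "q $ 2 \<noteq> 0"
  shows "invertible (S_mat p q)" "(\<lambda>x. S_mat p q *v x) ` triangle p = triangle q"
proof -
  let ?S = "\<lambda>x. S_mat p q *v x"
  have "det (S_mat p q) \<noteq> 0" using assms by (simp add: det_2 S_mat_def)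
  then show inv: "invertible (S_mat p q)" by (simp add: invertible_det_nz)
  have "?S (vector [0, 0]) = vector [0, 0]" "?S (vector [1, 0]) = vector [1, 0]" "?S p = q"
    using assms
    by (simp_all add: S_mat_def vec_eq_iff forall_2 matrix_vector_mul_component inner_vec_def sum_2)
  then have vertices: "?S ` {vector [0, 0], vector [1, 0], p} = {vector [0, 0], vector [1, 0], q}"
    by simp
  have lin: "linear ?S" by simp
  have "inj ?S" using inv by (simp add: inj_matrix_vector_mult)
  then show "?S ` triangle p = triangle q"
    unfolding triangle_def interior_injective_linear_image[OF lin \<open>inj ?S\<close>, symmetric]
      convex_hull_linear_image[OF lin] vertices by simp
qed

lemma triangle_lebesgue: "triangle p \<in> sets lebesgue"
  by (simp add: triangle_def)

text \<open>The eigenvalue equation is tested with \<open>u\<close> and with \<open>v\<close>. The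
  cross term is then eliminated through \<open>2 * L2_inner T u v = 2 - (L2_norm T (\<lambda>x. u x
  - v x))\<^sup>2\<close>, which uses both normalisations.\<close>

lemma eigenspace_gradient_dist:
  assumes u: "u \<in> eigenspace T \<mu>" "L2_norm T u = 1" and v: "v \<in> H10 T" "L2_norm T v = 1"
  shows "(L2_norm T (weak_gradient T u))\<^sup>2 = \<mu>"
    "(L2_norm T (\<lambda>x. weak_gradient T u x - weak_gradient T v x))\<^sup>2 =
      (L2_norm T (weak_gradient T v))\<^sup>2 - \<mu> + \<mu> * (L2_norm T (\<lambda>x. u x - v x))\<^sup>2"
proof -
  have uH: "u \<in> H10 T" using u(1) by (simp add: eigenspace_def)
  have eig: "L2_inner T (weak_gradient T u) (weak_gradient T w) = \<mu> * L2_inner T u w" if "w \<in> H10 T" for w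
    using u(1) that by (auto simp: eigenspace_def)
  show 1: "(L2_norm T (weak_gradient T u))\<^sup>2 = \<mu>"
    using eig[OF uH] L2_norm_power2[of T u] u(2) by (simp add: L2_norm_power2[of T "weak_gradient T u"])
  show "(L2_norm T (\<lambda>x. weak_gradient T u x - weak_gradient T v x))\<^sup>2 =
      (L2_norm T (weak_gradient T v))\<^sup>2 - \<mu> + \<mu> * (L2_norm T (\<lambda>x. u x - v x))\<^sup>2"
    using u(2) v(2) eig[OF v(1)]
    by (simp add: L2_norm_diff_power2 H10_L2 uH v(1) 1 algebra_simps)
qed

text \<open>\<open>L\<close> and \<open>d\<close> are left free so that the hatted and the tilde
  approximations are both instances, with \<open>L\<close> a maximal Rayleigh quotient and
  \<open>d\<close> a subspace distance.\<close>

lemma eigenspace_gradient_dist_le: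
  assumes u: "u \<in> eigenspace T \<mu>" "L2_norm T u = 1" and v: "v \<in> H10 T" "L2_norm T v = 1"
    and L: "(L2_norm T (weak_gradient T v))\<^sup>2 \<le> L" and d: "L2_norm T (\<lambda>x. u x - v x) \<le> d"
    and eta: "eta \<ge> 0" "eta\<^sup>2 = \<mu> * d\<^sup>2 + L - \<mu>"
  shows "L2_norm T (\<lambda>x. weak_gradient T u x - weak_gradient T v x) \<le> eta"
proof (rule power2_le_imp_le[OF _ eta(1)])
  \<comment> \<open>The sign of \<mu> is needed to replace the L2 error by its bound
    \<open>d\<close>; it holds since \<mu> is a squared gradient norm.\<close>
  have "\<mu> \<ge> 0" using eigenspace_gradient_dist(1)[OF u v] by (metis zero_le_power2)
  then have "\<mu> * (L2_norm T (\<lambda>x. u x - v x))\<^sup>2 \<le> \<mu> * d\<^sup>2"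
    using power_mono[OF d L2_norm_nonneg] by (intro mult_left_mono) auto
  then show "(L2_norm T (\<lambda>x. weak_gradient T u x - weak_gradient T v x))\<^sup>2 \<le> eta\<^sup>2"
    using L by (simp add: eigenspace_gradient_dist(2)[OF u v] eta(2))
qed

text \<open>The first argument goes from \<open>a\<close> over the intermediate \<open>b\<close> to
  \<open>c\<close> while \<open>v\<close> is kept, and only then is \<open>v\<close> replaced by
  \<open>w\<close>. Hence \<open>v\<close> weighs the first two errors and \<open>c\<close> the
  last. The value type is generic, so both gradients and scalar functions are covered.\<close>

lemma L2_inner_diff_le:
  assumes "a \<in> L2 T" "b \<in> L2 T" "c \<in> L2 T" "v \<in> L2 T" "w \<in> L2 T"
  shows "\<bar>L2_inner T a v - L2_inner T c w\<bar> \<le>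
    L2_norm T (\<lambda>x. a x - b x) * L2_norm T v + L2_norm T (\<lambda>x. b x - c x) * L2_norm T v
      + L2_norm T c * L2_norm T (\<lambda>x. v x - w x)"
proof -
  have "L2_inner T a v - L2_inner T c w = L2_inner T (\<lambda>x. a x - b x) v
      + L2_inner T (\<lambda>x. b x - c x) v + L2_inner T c (\<lambda>x. v x - w x)"
    using assms by (simp add: L2_inner_diff_left L2_inner_diff_right)
  then show ?thesis
    using L2_Cauchy_Schwarz[OF L2_diff[OF assms(1,2)] assms(4)]
      L2_Cauchy_Schwarz[OF L2_diff[OF assms(2,3)] assms(4)]
      L2_Cauchy_Schwarz[OF assms(3) L2_diff[OF assms(4,5)]] by linarith
qed

text \<open>The first argument passes from the tilde function over \<open>u_star i\<close> to
  \<open>u_hat i\<close>, the second from \<open>u_star j\<close> to \<open>u_hat j\<close>. In the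
  gradient estimate the two hatted errors carry the different weights \<open>sqrt (lam N)\<close>
  and \<open>sqrt lam_hat_N\<close>; the premise \<open>lam N \<le> lam_hat_N\<close> lets them
  share the larger one. In the L2 estimate all weights are 1, so it is stated outside that
  premise.\<close>

theorem lemma3p4:
  fixes p e :: "real^2" and t :: real and n N :: nat
    and T0 Tt :: "(real^2) set"
    and lam lam_t :: "nat \<Rightarrow> real"
    and u u_tilde u_hat u_star u_tilde_star :: "nat \<Rightarrow> real^2 \<Rightarrow> real"
    and E E_tilde E_hat :: "(real^2 \<Rightarrow> real) set"
    and lam_tilde_N lam_hat_N eta_hat eta_tilde :: real
    and P :: "real^2^2"
  assumes p: "p $ 2 \<noteq> 0"
    and e: "norm e = 1"
    and t: "t > 0"
    and pt: "(p + t *\<^sub>R e) $ 2 \<noteq> 0"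
    and T0: "T0 = triangle p"
    and Tt: "Tt = triangle (p + t *\<^sub>R e)"
    and lam: "\<And>i. lam i = dirichlet_eigenvalue T0 i"
    and lam_t: "\<And>i. lam_t i = dirichlet_eigenvalue Tt i"
    and indices: "1 \<le> n" "n \<le> N"
    and cluster: "\<And>i. i \<in> {n..N} \<Longrightarrow> lam i = lam n"
    and E: "E = eigenspace T0 (lam n)"
    and u: "\<And>i. i \<in> {n..N} \<Longrightarrow> eigenfunction Tt (lam_t i) (u i)"
    and u_indep: "L2_indep Tt u {n..N}"
    and u_tilde: "\<And>i. u_tilde i = (\<lambda>x. u i (S_mat p (p + t *\<^sub>R e) *v x))"
    and E_tilde: "E_tilde = L2_span T0 u_tilde {n..N}"
    and lam_tilde_N: "lam_tilde_N = max_rayleigh T0 E_tilde"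
    and P: "P = P_mat p e t"
    and u_hat: "\<And>i. i \<in> {n..N} \<Longrightarrow> u_hat i \<in> H10 T0 \<and> L2_norm T0 (u_hat i) = 1"
    and E_hat: "E_hat = L2_span T0 u_hat {n..N}"
    and lam_hat_N: "lam_hat_N = max_rayleigh T0 E_hat"
    and u_star: "\<And>i. i \<in> {n..N} \<Longrightarrow> u_star i \<in> E \<and> L2_norm T0 (u_star i) = 1 \<and>
        L2_norm T0 (\<lambda>x. u_hat i x - u_star i x) \<le> delta_b T0 E_hat E"
    and u_tilde_star: "\<And>i. i \<in> {n..N} \<Longrightarrow>
        u_tilde_star i \<in> E_tilde \<and> L2_norm T0 (u_tilde_star i) = 1 \<and>
        L2_norm T0 (\<lambda>x. u_star i x - u_tilde_star i x) \<le> delta_b T0 E E_tilde"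
    and eta_hat: "eta_hat \<ge> 0"
        "eta_hat\<^sup>2 = lam N * (delta_b T0 E_hat E)\<^sup>2 + lam_hat_N - lam n"
    and eta_tilde: "eta_tilde \<ge> 0"
        "eta_tilde\<^sup>2 = lam N * (delta_b T0 E E_tilde)\<^sup>2 + lam_tilde_N - lam n"
  shows "\<forall>i\<in>{n..N}. \<forall>j\<in>{n..N}.
      (lam N \<le> lam_hat_N \<longrightarrow>
        \<bar>F_form T0 P (u_tilde_star i) (u_star j) - F_form T0 P (u_hat i) (u_hat j)\<bar>
          \<le> spectral_norm P * (2 * eta_hat * sqrt lam_hat_N + eta_tilde * sqrt (lam N)))
    \<and> \<bar>L2_inner T0 (u_tilde_star i) (u_star j) - L2_inner T0 (u_hat i) (u_hat j)\<bar>
        \<le> 2 * delta_b T0 E_hat E + delta_b T0 E E_tilde"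
proof (intro ballI)
  fix i j assume i: "i \<in> {n..N}" and j: "j \<in> {n..N}"
  let ?G = "weak_gradient T0" and ?S = "S_mat p (p + t *\<^sub>R e)"
  let ?s = "spectral_norm P" and ?dh = "delta_b T0 E_hat E" and ?dt = "delta_b T0 E E_tilde"
  have T: "T0 \<in> sets lebesgue" "Tt \<in> sets lebesgue" by (simp_all add: T0 Tt triangle_lebesgue)
  \<comment> \<open>The definitions of the two error quantities mix \<open>lam N\<close> and
    \<open>lam n\<close>; identifying them gives the single eigenvalue required by the gradient
    error lemma.\<close>
  have lamN: "lam N = lam n" using cluster[of N] indices by simp
  have image: "(\<lambda>x. ?S *v x) ` T0 = Tt" and inv: "invertible ?S"
    using S_mat_props[OF p pt] by (simp_all add: T0 Tt)
  have u_tilde_H10: "u_tilde k \<in> H10 T0" if "k \<in> {n..N}" for k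
  proof -
    have "u k \<in> H10 Tt" using u[OF that] by (simp add: eigenfunction_def eigenspace_def)
    then have "has_H10_gradient ((\<lambda>x. ?S *v x) ` T0) (u k) (weak_gradient Tt (u k))"
      unfolding image by (rule has_H10_gradient_weak_gradient)
    from has_H10_gradient_matrix_compose[OF inv T(1) _ this] show ?thesis
      using T(2) by (auto simp: image u_tilde H10_def)
  qed
  have u_hat_H10: "u_hat k \<in> H10 T0" if "k \<in> {n..N}" for k using u_hat[OF that] by simp
  have star: "u_star k \<in> eigenspace T0 (lam n)" "u_star k \<in> H10 T0" "L2_norm T0 (u_star k) = 1"
    "L2_norm T0 (\<lambda>x. u_star k x - u_hat k x) \<le> ?dh"
    "L2_norm T0 (\<lambda>x. u_star k x - u_tilde_star k x) \<le> ?dt" if "k \<in> {n..N}" for k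
    using u_star[OF that] u_tilde_star[OF that] E L2_norm_minus_commute[of T0 "u_star k" "u_hat k"]
    by (auto simp: eigenspace_def)
  have tilde: "u_tilde_star k \<in> L2_span T0 u_tilde {n..N}" "L2_norm T0 (u_tilde_star k) = 1"
    if "k \<in> {n..N}" for k using u_tilde_star[OF that] E_tilde by auto
  have tilde_H10: "u_tilde_star k \<in> H10 T0" if "k \<in> {n..N}" for k
    by (rule L2_span_H10[OF T(1) _ u_tilde_H10 tilde(1)[OF that]]) auto
  have hat: "u_hat k \<in> L2_span T0 u_hat {n..N}" "L2_norm T0 (u_hat k) = 1" if k: "k \<in> {n..N}" for k
  proof -
    have "(\<Sum>l\<in>{n..N}. (if l = k then 1 else 0) * u_hat l x) = u_hat k x" for x
      using k by (simp add: if_distrib[of "\<lambda>c. c * _"] cong: if_cong)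
    then show "u_hat k \<in> L2_span T0 u_hat {n..N}" unfolding L2_span_def
      by (auto intro!: exI[of _ "\<lambda>l. if l = k then 1 else 0"])
  qed (use u_hat[OF k] in simp)
  have ray_hat: "(L2_norm T0 (?G (u_hat k)))\<^sup>2 \<le> lam_hat_N" if k: "k \<in> {n..N}" for k
    using rayleigh_le_max_rayleigh[OF T(1) _ u_hat_H10 hat(1)[OF k]] hat(2)[OF k]
    by (simp add: lam_hat_N E_hat)
  have ray_tilde: "(L2_norm T0 (?G (u_tilde_star k)))\<^sup>2 \<le> lam_tilde_N" if k: "k \<in> {n..N}" for k
    using rayleigh_le_max_rayleigh[OF T(1) _ u_tilde_H10 tilde(1)[OF k]] tilde(2)[OF k]
    by (simp add: lam_tilde_N E_tilde)
  have grad_hat: "L2_norm T0 (\<lambda>x. ?G (u_star k) x - ?G (u_hat k) x) \<le> eta_hat" if k: "k \<in> {n..N}" for k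
    by (rule eigenspace_gradient_dist_le[OF star(1,3)[OF k] u_hat_H10[OF k] hat(2)[OF k]
          ray_hat[OF k] star(4)[OF k] eta_hat[unfolded lamN]])
  have grad_tilde: "L2_norm T0 (\<lambda>x. ?G (u_star k) x - ?G (u_tilde_star k) x) \<le> eta_tilde"
    if k: "k \<in> {n..N}" for k
    by (rule eigenspace_gradient_dist_le[OF star(1,3)[OF k] tilde_H10[OF k] tilde(2)[OF k]
          ray_tilde[OF k] star(5)[OF k] eta_tilde[unfolded lamN]])
  have norm_star: "L2_norm T0 (?G (u_star k)) = sqrt (lam N)" if k: "k \<in> {n..N}" for k
    using eigenspace_gradient_dist(1)[OF star(1,3)[OF k] u_hat_H10[OF k] hat(2)[OF k]] lamN
    by (metis L2_norm_nonneg real_sqrt_unique)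
  have norm_hat: "L2_norm T0 (?G (u_hat k)) \<le> sqrt lam_hat_N" if k: "k \<in> {n..N}" for k
    using ray_hat[OF k] by (rule real_le_rsqrt)
  have s0: "?s \<ge> 0" unfolding spectral_norm_def by (rule onorm_pos_le) (simp add: linear_linear)
  have lam0: "lam N \<ge> 0" using norm_star[OF j] L2_norm_nonneg by (metis real_sqrt_ge_0_iff)
  have lam0: "lam N \<ge> 0" using norm_star[OF j] L2_norm_nonneg by (metis real_sqrt_ge_0_iff)
  \<comment> \<open>Odd positions hold the functions, even positions their weak gradients, in the
    order tilde, star, hat for \<open>i\<close> and then star, hat for \<open>j\<close>.\<close>
  note L2 = H10_L2[OF tilde_H10[OF i]] H10_L2[OF star(2)[OF i]] H10_L2[OF u_hat_H10[OF i]]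
    H10_L2[OF star(2)[OF j]] H10_L2[OF u_hat_H10[OF j]]
  have "\<bar>F_form T0 P (u_tilde_star i) (u_star j) - F_form T0 P (u_hat i) (u_hat j)\<bar>
      \<le> ?s * (2 * eta_hat * sqrt lam_hat_N + eta_tilde * sqrt (lam N))" if le: "lam N \<le> lam_hat_N"
  proof -
    have "\<bar>F_form T0 P (u_tilde_star i) (u_star j) - F_form T0 P (u_hat i) (u_hat j)\<bar>
      \<le> L2_norm T0 (\<lambda>x. P *v ?G (u_tilde_star i) x - P *v ?G (u_star i) x) * sqrt (lam N)
        + L2_norm T0 (\<lambda>x. P *v ?G (u_star i) x - P *v ?G (u_hat i) x) * sqrt (lam N)
        + L2_norm T0 (\<lambda>x. P *v ?G (u_hat i) x) * L2_norm T0 (\<lambda>x. ?G (u_star j) x - ?G (u_hat j) x)"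
      unfolding F_form_def norm_star[OF j, symmetric]
      by (rule L2_inner_diff_le) (rule L2_matrix(1) L2)+
    \<comment> \<open>Only the middle summand raises \<open>sqrt (lam N)\<close> to
      \<open>sqrt lam_hat_N\<close>; this is where \<open>le\<close> enters. Matching the last
      summand, it produces the factor 2.\<close>
    also have "\<dots> \<le> (?s * eta_tilde) * sqrt (lam N) + (?s * eta_hat) * sqrt lam_hat_N
        + (?s * sqrt lam_hat_N) * eta_hat"
    proof (intro add_mono mult_mono)
      show "L2_norm T0 (\<lambda>x. P *v ?G (u_tilde_star i) x - P *v ?G (u_star i) x) \<le> ?s * eta_tilde"
        using L2_matrix(2)[OF L2_diff[OF L2(2,4)], of P] mult_left_mono[OF grad_tilde[OF i] s0]
        by (simp add: matrix_vector_mult_diff_distrib L2_norm_minus_commute[of T0 "?G (u_star i)"])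
      show "L2_norm T0 (\<lambda>x. P *v ?G (u_star i) x - P *v ?G (u_hat i) x) \<le> ?s * eta_hat"
        using L2_matrix(2)[OF L2_diff[OF L2(4,6)], of P] mult_left_mono[OF grad_hat[OF i] s0]
        by (simp add: matrix_vector_mult_diff_distrib)
      show "L2_norm T0 (\<lambda>x. P *v ?G (u_hat i) x) \<le> ?s * sqrt lam_hat_N"
        using L2_matrix(2)[OF L2(6), of P] mult_left_mono[OF norm_hat[OF i] s0] by simp
      have "lam_hat_N \<ge> 0" using ray_hat[OF i] zero_le_power2 order_trans by blast
      then show "0 \<le> ?s * sqrt lam_hat_N" using s0 by simp
    qed (use le lam0 s0 eta_hat(1) eta_tilde(1) grad_hat[OF j] in \<open>auto simp: L2_norm_nonneg\<close>)
    finally show ?thesis by (simp add: algebra_simps)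
  qed
  \<comment> \<open>The same three exchanges without gradients: the weights are the norms of
    \<open>u_star j\<close> and \<open>u_hat i\<close>, both equal to 1.\<close>
  moreover have "\<bar>L2_inner T0 (u_tilde_star i) (u_star j) - L2_inner T0 (u_hat i) (u_hat j)\<bar>
      \<le> 2 * ?dh + ?dt"
    using L2_inner_diff_le[OF L2(1,3,5,7,9)] star(4)[OF j] star(4,5)[OF i]
      L2_norm_minus_commute[of T0 "u_star i" "u_tilde_star i"]
    by (simp add: star(3)[OF j] hat(2)[OF i])
  ultimately show "(lam N \<le> lam_hat_N \<longrightarrow>
        \<bar>F_form T0 P (u_tilde_star i) (u_star j) - F_form T0 P (u_hat i) (u_hat j)\<bar>
          \<le> ?s * (2 * eta_hat * sqrt lam_hat_N + eta_tilde * sqrt (lam N)))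
    \<and> \<bar>L2_inner T0 (u_tilde_star i) (u_star j) - L2_inner T0 (u_hat i) (u_hat j)\<bar>
        \<le> 2 * ?dh + ?dt" by blast
qed

end
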